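(* Let $n\ge 3$, $\rho\in\{1,-1\}$ and $(q,\theta_1,\theta_2)\in\mathcal{P}$, and let $\mathbb{C}_q$ be the corresponding quantum torus with involution. Let $\mathcal{J}$ be an ideal of the Lie algebra $\mathfrak{g}_{2n,\rho}(\mathbb{C}_q)$ such that $\mathfrak{g}_{2n,\rho}(\mathbb{C}_q)/\mathcal{J}$ is finite-dimensional and semisimple. Then there exist $f,g\in\mathbb{C}[T]$ with $f(0)g(0)\ne0$, $\deg f\deg g>0$, $\gcd(f,f')=1$, $\gcd(g,g')=1$, $f(\theta_1^mT)=f(T)$ and $g(\theta_2^mT)=g(T)$, such that $$\mathcal{J}\supset\overline{\mathfrak{g}_{2n,\rho}}(J(f,g))=\underline{\mathfrak{g}_{2n,\rho}}(J(f,g)).$$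
   Context: Lie algebra $\mathfrak{g}_{2n,\rho}(R)$: let $R$ be a unital associative algebra over a field $k$ of characteristic $0$ with an involution, i.e. a $k$-linear map $a\mapsto\bar a$ with $\overline{ab}=\bar b\,\bar a$ and $\bar{\bar a}=a$. For $\rho\in\{1,-1\}$, $a\in R$, let $e_{ij}(a)\in\mathfrak{gl}_{2n}(R)$ be the matrix with $a$ in position $(i,j)$ and $0$ elsewhere, and for $1\le i,j\le n$ put $f_{ij}(a)=e_{ij}(a)-e_{n+j,n+i}(\bar a)$, $g_{ij}(a)=e_{i,n+j}(a)-\rho e_{j,n+i}(\bar a)$, $h_{ij}(a)=e_{n+i,j}(a)-\rho e_{n+j,i}(\bar a)$. Then $\mathfrak{g}_{2n,\rho}(R)$ is the Lie subalgebra of $\mathfrak{gl}_{2n}(R)$ generated by all $f_{ij}(a)$ ($i\ne j$), $g_{ij}(a)$, $h_{ij}(a)$ ($i\le j$), $a\in R$. Let $R_\pm=\{a\in R:\bar a=\pm a\}$. An involutive ideal of $R$ is a two-sided ideal $J$ closed under the involution; $J_\pm=J\cap R_\pm$; $[J,R]$ and $[R,R]$ denote spans of commutators. For subsets $S\subset R$ write $f_{ij}(S)=\{f_{ij}(a):a\in S\}$, etc., and $(f_{ii}-f_{11})(a)=f_{ii}(a)-f_{11}(a)$. With $\Delta(J)=\sum_{i\ne j}f_{ij}(J)\oplus\sum_{i\le j}(g_{ij}(J)\oplus h_{ij}(J))$ define $$\overline{\mathfrak{g}_{2n,\rho}}(J)=f_{11}((R_++[R,R])\cap J)\oplus\sum_{i=2}^n(f_{ii}-f_{11})(J)\oplus\Delta(J),$$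 $$\underline{\mathfrak{g}_{2n,\rho}}(J)=f_{11}(J_++[J,R])\oplus\sum_{i=2}^n(f_{ii}-f_{11})(J)\oplus\Delta(J).$$ Quantum torus: for $q\in\{1,-1\}$, $\mathbb{C}_q$ is the associative $\mathbb{C}$-algebra generated by $t_1^{\pm1},t_2^{\pm1}$ with relations $t_it_i^{-1}=t_i^{-1}t_i=1$ and $t_2t_1=qt_1t_2$; $m$ is the order of $q$ ($m=1$ if $q=1$, $m=2$ if $q=-1$). It carries the $\mathbb{C}$-linear involution with $\overline{t_1}=\theta_1t_1$, $\overline{t_2}=\theta_2t_2$. $\mathcal{P}=\{(-1,1,1),(-1,1,-1),(-1,-1,-1),(1,1,1),(1,1,-1),(1,-1,-1)\}$ is the set of triples $(q,\theta_1,\theta_2)$ considered. For $f,g\in\mathbb{C}[T]$ with $f(0)g(0)\neq0$ and $\deg f\deg g>0$, $J(f,g)$ is the ideal of $\mathbb{C}_q$ generated by $f(t_1^m)$ and $g(t_2^m)$ (under the conditions in the claim it is an involutive ideal). $f'$ denotes the formal derivative. *)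

theory Defs
  imports
    Complex_Main
    "HOL-Library.Function_Algebras"
    "HOL-Library.Poly_Mapping"
    "HOL-Computational_Algebra.Computational_Algebra"
    "HOL-Computational_Algebra.Field_as_Ring"
begin

section \<open>Associative algebras with involution\<close>

text \<open>The underlying additive group is the one of the type; the remaining operations are explicit,
  so that a family of algebras (such as the quantum tori, indexed by \<open>q\<close>) can live on one type.\<close>

record ('k, 'r) alg =
  scal :: "'k \<Rightarrow> 'r \<Rightarrow> 'r"
  amul :: "'r \<Rightarrow> 'r \<Rightarrow> 'r"
  aone :: 'r

record ('k, 'r) inv_alg = "('k, 'r) alg" +
  bar :: "'r \<Rightarrow> 'r"

locale unital_algebra =
  fixes R :: "('k::field, 'r::ab_group_add, 'm) alg_scheme"
  assumes vector_space: "vector_space (scal R)"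
    and mul_assoc: "amul R (amul R a b) c = amul R a (amul R b c)"
    and one_mul: "amul R (aone R) a = a"
    and mul_one: "amul R a (aone R) = a"
    and add_mul: "amul R (a + b) c = amul R a c + amul R b c"
    and mul_add: "amul R a (b + c) = amul R a b + amul R a c"
    and scal_mul: "amul R (scal R s a) b = scal R s (amul R a b)"
    and mul_scal: "amul R a (scal R s b) = scal R s (amul R a b)"

locale involutive_algebra = unital_algebra R
  for R :: "('k::field_char_0, 'r::ab_group_add, 'm) inv_alg_scheme" +
  assumes bar_add: "bar R (a + b) = bar R a + bar R b"
    and bar_scal: "bar R (scal R s a) = scal R s (bar R a)"
    and bar_mul: "bar R (amul R a b) = amul R (bar R b) (bar R a)"
    and bar_bar: "bar R (bar R a) = a"

definition apow :: "('k, 'r, 'm) alg_scheme \<Rightarrow> 'r \<Rightarrow> nat \<Rightarrow> 'r" where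
  "apow R x i = (amul R x ^^ i) (aone R)"

definition apoly :: "('k::zero, 'r::ab_group_add, 'm) alg_scheme \<Rightarrow> 'k poly \<Rightarrow> 'r \<Rightarrow> 'r" where
  "apoly R p x = (\<Sum>i\<le>degree p. scal R (coeff p i) (apow R x i))"

definition alg_ideal :: "('k::field, 'r::ab_group_add, 'm) alg_scheme \<Rightarrow> 'r set \<Rightarrow> bool" where
  "alg_ideal R J \<longleftrightarrow> module.subspace (scal R) J \<and>
     (\<forall>r. \<forall>x\<in>J. amul R r x \<in> J \<and> amul R x r \<in> J)"

definition gen_ideal :: "('k::field, 'r::ab_group_add, 'm) alg_scheme \<Rightarrow> 'r set \<Rightarrow> 'r set" where
  "gen_ideal R S = \<Inter>{J. alg_ideal R J \<and> S \<subseteq> J}"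

definition comm_span ::
    "('k::field, 'r::ab_group_add, 'm) alg_scheme \<Rightarrow> 'r set \<Rightarrow> 'r set \<Rightarrow> 'r set" where
  "comm_span R S T =
     module.span (scal R) {amul R a b - amul R b a | a b. a \<in> S \<and> b \<in> T}"

definition sym_part :: "('k, 'r, 'm) inv_alg_scheme \<Rightarrow> 'r set" where
  "sym_part R = {a. bar R a = a}"


section \<open>Lie algebras\<close>

record ('k, 'v) lie_alg =
  carr :: "'v set"
  lzero :: 'v
  ladd :: "'v \<Rightarrow> 'v \<Rightarrow> 'v"
  lscal :: "'k \<Rightarrow> 'v \<Rightarrow> 'v"
  brk :: "'v \<Rightarrow> 'v \<Rightarrow> 'v"

definition lin_subspace :: "('k, 'v) lie_alg \<Rightarrow> 'v set \<Rightarrow> bool" where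
  "lin_subspace L U \<longleftrightarrow> U \<subseteq> carr L \<and> lzero L \<in> U \<and>
     (\<forall>x\<in>U. \<forall>y\<in>U. ladd L x y \<in> U) \<and> (\<forall>c. \<forall>x\<in>U. lscal L c x \<in> U)"

definition lin_span :: "('k, 'v) lie_alg \<Rightarrow> 'v set \<Rightarrow> 'v set" where
  "lin_span L S = \<Inter>{U. lin_subspace L U \<and> S \<subseteq> U}"

definition lie_subalgebra :: "('k, 'v) lie_alg \<Rightarrow> 'v set \<Rightarrow> bool" where
  "lie_subalgebra L U \<longleftrightarrow> lin_subspace L U \<and> (\<forall>x\<in>U. \<forall>y\<in>U. brk L x y \<in> U)"

definition lie_generated :: "('k, 'v) lie_alg \<Rightarrow> 'v set \<Rightarrow> 'v set" where
  "lie_generated L S = \<Inter>{U. lie_subalgebra L U \<and> S \<subseteq> U}"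

definition lie_ideal :: "('k, 'v) lie_alg \<Rightarrow> 'v set \<Rightarrow> bool" where
  "lie_ideal L I \<longleftrightarrow> lin_subspace L I \<and> (\<forall>x\<in>carr L. \<forall>y\<in>I. brk L x y \<in> I)"

definition lie_coset :: "('k, 'v) lie_alg \<Rightarrow> 'v set \<Rightarrow> 'v \<Rightarrow> 'v set" where
  "lie_coset L I x = ladd L x ` I"

definition lie_quotient :: "('k, 'v) lie_alg \<Rightarrow> 'v set \<Rightarrow> ('k, 'v set) lie_alg" where
  "lie_quotient L I =
     \<lparr> carr = lie_coset L I ` carr L,
       lzero = I,
       ladd = (\<lambda>A B. \<Union>a\<in>A. \<Union>b\<in>B. lie_coset L I (ladd L a b)),
       lscal = (\<lambda>c A. \<Union>a\<in>A. lie_coset L I (lscal L c a)),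
       brk = (\<lambda>A B. \<Union>a\<in>A. \<Union>b\<in>B. lie_coset L I (brk L a b)) \<rparr>"

definition lie_finite_dim :: "('k, 'v) lie_alg \<Rightarrow> bool" where
  "lie_finite_dim L \<longleftrightarrow> (\<exists>B. finite B \<and> B \<subseteq> carr L \<and> lin_span L B = carr L)"

definition lie_derived :: "('k, 'v) lie_alg \<Rightarrow> 'v set \<Rightarrow> 'v set" where
  "lie_derived L U = lin_span L {brk L x y | x y. x \<in> U \<and> y \<in> U}"

definition lie_solvable :: "('k, 'v) lie_alg \<Rightarrow> 'v set \<Rightarrow> bool" where
  "lie_solvable L U \<longleftrightarrow> (\<exists>i. (lie_derived L ^^ i) U = {lzero L})"

text \<open>Zero radical; the zero Lie algebra counts as semisimple.\<close>

definition lie_semisimple :: "('k, 'v) lie_alg \<Rightarrow> bool" where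
  "lie_semisimple L \<longleftrightarrow> (\<forall>I. lie_ideal L I \<and> lie_solvable L I \<longrightarrow> I = {lzero L})"


section \<open>The Lie algebras of matrices over an algebra with involution\<close>

text \<open>A matrix of size \<open>N\<close> is a function on pairs of indices that vanishes outside \<open>{1..N}\<close>.\<close>

type_synonym 'r matr = "nat \<Rightarrow> nat \<Rightarrow> 'r"

definition mat_mul ::
    "('k, 'r::ab_group_add, 'm) alg_scheme \<Rightarrow> nat \<Rightarrow> 'r matr \<Rightarrow> 'r matr \<Rightarrow> 'r matr" where
  "mat_mul R N A B = (\<lambda>i j. \<Sum>l=1..N. amul R (A i l) (B l j))"

definition mat_scal :: "('k, 'r, 'm) alg_scheme \<Rightarrow> 'k \<Rightarrow> 'r matr \<Rightarrow> 'r matr" where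
  "mat_scal R c A = (\<lambda>i j. scal R c (A i j))"

definition gl :: "('k, 'r::ab_group_add, 'm) alg_scheme \<Rightarrow> nat \<Rightarrow> ('k, 'r matr) lie_alg" where
  "gl R N =
     \<lparr> carr = {A. \<forall>i j. i \<notin> {1..N} \<or> j \<notin> {1..N} \<longrightarrow> A i j = 0},
       lzero = 0,
       ladd = (+),
       lscal = mat_scal R,
       brk = (\<lambda>A B. mat_mul R N A B - mat_mul R N B A) \<rparr>"

definition emat :: "nat \<Rightarrow> nat \<Rightarrow> 'r::zero \<Rightarrow> 'r matr" where
  "emat i j a = (\<lambda>k l. if k = i \<and> l = j then a else 0)"

definition fmat ::
    "('k, 'r::ab_group_add, 'm) inv_alg_scheme \<Rightarrow> nat \<Rightarrow> nat \<Rightarrow> nat \<Rightarrow> 'r \<Rightarrow> 'r matr" where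
  "fmat R n i j a = emat i j a - emat (n + j) (n + i) (bar R a)"

definition gmat ::
    "('k, 'r::ab_group_add, 'm) inv_alg_scheme \<Rightarrow> nat \<Rightarrow> 'k \<Rightarrow> nat \<Rightarrow> nat \<Rightarrow> 'r \<Rightarrow> 'r matr" where
  "gmat R n \<rho> i j a = emat i (n + j) a - mat_scal R \<rho> (emat j (n + i) (bar R a))"

definition hmat ::
    "('k, 'r::ab_group_add, 'm) inv_alg_scheme \<Rightarrow> nat \<Rightarrow> 'k \<Rightarrow> nat \<Rightarrow> nat \<Rightarrow> 'r \<Rightarrow> 'r matr" where
  "hmat R n \<rho> i j a = emat (n + i) j a - mat_scal R \<rho> (emat (n + j) i (bar R a))"

text \<open>The union of the \<open>f\<^sub>i\<^sub>j(J)\<close> for \<open>i \<noteq> j\<close> and of the \<open>g\<^sub>i\<^sub>j(J)\<close>, \<open>h\<^sub>i\<^sub>j(J)\<close> for \<open>i \<le> j\<close>.\<close>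

definition root_elems ::
    "('k, 'r::ab_group_add, 'm) inv_alg_scheme \<Rightarrow> nat \<Rightarrow> 'k \<Rightarrow> 'r set \<Rightarrow> 'r matr set" where
  "root_elems R n \<rho> J =
     {fmat R n i j a | i j a. i \<in> {1..n} \<and> j \<in> {1..n} \<and> i \<noteq> j \<and> a \<in> J} \<union>
     {gmat R n \<rho> i j a | i j a. i \<in> {1..n} \<and> j \<in> {1..n} \<and> i \<le> j \<and> a \<in> J} \<union>
     {hmat R n \<rho> i j a | i j a. i \<in> {1..n} \<and> j \<in> {1..n} \<and> i \<le> j \<and> a \<in> J}"

definition g_lie ::
    "('k, 'r::ab_group_add, 'm) inv_alg_scheme \<Rightarrow> nat \<Rightarrow> 'k \<Rightarrow> ('k, 'r matr) lie_alg" where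
  "g_lie R n \<rho> =
     (gl R (2 * n)) \<lparr> carr := lie_generated (gl R (2 * n)) (root_elems R n \<rho> UNIV) \<rparr>"

text \<open>\<open>f\<^sub>1\<^sub>1(D) \<oplus> \<Sum>\<^sub>i (f\<^sub>i\<^sub>i - f\<^sub>1\<^sub>1)(J) \<oplus> \<Delta>(J)\<close>. Internal sums of subspaces are spans of unions; for
  subspaces \<open>D\<close>, \<open>J\<close> the summands occupy disjoint matrix positions or are visibly independent
  on the diagonal, so directness needs no separate clause.\<close>

definition g_sum ::
    "('k, 'r::ab_group_add, 'm) inv_alg_scheme \<Rightarrow> nat \<Rightarrow> 'k \<Rightarrow> 'r set \<Rightarrow> 'r set \<Rightarrow> 'r matr set" where
  "g_sum R n \<rho> D J = lin_span (gl R (2 * n))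
     (fmat R n 1 1 ` D \<union>
      {fmat R n i i a - fmat R n 1 1 a | i a. i \<in> {2..n} \<and> a \<in> J} \<union>
      root_elems R n \<rho> J)"

definition g_over ::
    "('k::field, 'r::ab_group_add, 'm) inv_alg_scheme \<Rightarrow> nat \<Rightarrow> 'k \<Rightarrow> 'r set \<Rightarrow> 'r matr set" where
  "g_over R n \<rho> J =
     g_sum R n \<rho> ({a + b | a b. a \<in> sym_part R \<and> b \<in> comm_span R UNIV UNIV} \<inter> J) J"

definition g_under ::
    "('k::field, 'r::ab_group_add, 'm) inv_alg_scheme \<Rightarrow> nat \<Rightarrow> 'k \<Rightarrow> 'r set \<Rightarrow> 'r matr set" where
  "g_under R n \<rho> J =
     g_sum R n \<rho> {a + b | a b. a \<in> J \<inter> sym_part R \<and> b \<in> comm_span R J UNIV} J"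


section \<open>Quantum tori\<close>

text \<open>\<open>\<complex>\<^sub>q\<close> is realised on its basis of monomials: \<open>Poly_Mapping.single (a, b) 1\<close> stands for
  \<open>t\<^sub>1\<^sup>a t\<^sub>2\<^sup>b\<close>. The relation \<open>t\<^sub>2 t\<^sub>1 = q t\<^sub>1 t\<^sub>2\<close> gives
  \<open>t\<^sub>1\<^sup>a t\<^sub>2\<^sup>b \<cdot> t\<^sub>1\<^sup>c t\<^sub>2\<^sup>d = q\<^sup>b\<^sup>c t\<^sub>1\<^sup>a\<^sup>+\<^sup>c t\<^sub>2\<^sup>b\<^sup>+\<^sup>d\<close>, and the involution sends \<open>t\<^sub>1\<^sup>a t\<^sub>2\<^sup>b\<close> to
  \<open>(\<theta>\<^sub>2 t\<^sub>2)\<^sup>b (\<theta>\<^sub>1 t\<^sub>1)\<^sup>a = \<theta>\<^sub>1\<^sup>a \<theta>\<^sub>2\<^sup>b q\<^sup>a\<^sup>b t\<^sub>1\<^sup>a t\<^sub>2\<^sup>b\<close>. The presentation and the characterisation of the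
  involution are \<open>qtorus_universal\<close> and \<open>qtorus_bar_unique\<close> below.\<close>

type_synonym laurent2 = "(int \<times> int) \<Rightarrow>\<^sub>0 complex"

definition qmul :: "complex \<Rightarrow> laurent2 \<Rightarrow> laurent2 \<Rightarrow> laurent2" where
  "qmul q x y = (\<Sum>(a, b)\<in>Poly_Mapping.keys x. \<Sum>(c, d)\<in>Poly_Mapping.keys y.
     Poly_Mapping.single (a + c, b + d)
       (Poly_Mapping.lookup x (a, b) * Poly_Mapping.lookup y (c, d) * q powi (b * c)))"

definition qbar :: "complex \<Rightarrow> complex \<Rightarrow> complex \<Rightarrow> laurent2 \<Rightarrow> laurent2" where
  "qbar q \<theta>1 \<theta>2 x = (\<Sum>(a, b)\<in>Poly_Mapping.keys x.
     Poly_Mapping.single (a, b)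
       (Poly_Mapping.lookup x (a, b) * (\<theta>1 powi a * \<theta>2 powi b * q powi (a * b))))"

definition qtorus :: "complex \<Rightarrow> complex \<Rightarrow> complex \<Rightarrow> (complex, laurent2) inv_alg" where
  "qtorus q \<theta>1 \<theta>2 =
     \<lparr> scal = (\<lambda>c. Poly_Mapping.map ((*) c)),
       amul = qmul q,
       aone = Poly_Mapping.single (0, 0) 1,
       bar = qbar q \<theta>1 \<theta>2 \<rparr>"

definition t1 :: laurent2 where "t1 = Poly_Mapping.single (1, 0) 1"
definition t1_inv :: laurent2 where "t1_inv = Poly_Mapping.single (-1, 0) 1"
definition t2 :: laurent2 where "t2 = Poly_Mapping.single (0, 1) 1"
definition t2_inv :: laurent2 where "t2_inv = Poly_Mapping.single (0, -1) 1"

definition mult_order :: "complex \<Rightarrow> nat" where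
  "mult_order q = (LEAST m. m > 0 \<and> q ^ m = 1)"

definition qtriples :: "(complex \<times> complex \<times> complex) set" where
  "qtriples = {(-1, 1, 1), (-1, 1, -1), (-1, -1, -1), (1, 1, 1), (1, 1, -1), (1, -1, -1)}"

definition J_ideal ::
    "complex \<Rightarrow> complex \<Rightarrow> complex \<Rightarrow> complex poly \<Rightarrow> complex poly \<Rightarrow> laurent2 set" where
  "J_ideal q \<theta>1 \<theta>2 f g = (let R = qtorus q \<theta>1 \<theta>2; m = mult_order q in
     gen_ideal R {apoly R f (apow R t1 m), apoly R g (apow R t2 m)})"


subsection \<open>Quantum tori are algebras with involution\<close>

lemma pm_sum_superset:
  fixes F :: "'a \<Rightarrow> 'b::zero \<Rightarrow> 'c::comm_monoid_add"
  assumes "finite A" "Poly_Mapping.keys x \<subseteq> A" "\<And>k. F k 0 = 0"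
  shows "(\<Sum>k\<in>Poly_Mapping.keys x. F k (Poly_Mapping.lookup x k)) =
         (\<Sum>k\<in>A. F k (Poly_Mapping.lookup x k))"
  using assms by (intro sum.mono_neutral_left) (auto simp: Poly_Mapping.in_keys_iff)

lemma pm_sum_add:
  fixes F :: "'a \<Rightarrow> 'b::comm_monoid_add \<Rightarrow> 'c::comm_monoid_add"
  assumes F0: "\<And>k. F k 0 = 0" and Fadd: "\<And>k a b. F k (a + b) = F k a + F k b"
  shows "(\<Sum>k\<in>Poly_Mapping.keys (x + y). F k (Poly_Mapping.lookup (x + y) k)) =
         (\<Sum>k\<in>Poly_Mapping.keys x. F k (Poly_Mapping.lookup x k)) +
         (\<Sum>k\<in>Poly_Mapping.keys y. F k (Poly_Mapping.lookup y k))"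
proof -
  let ?A = "Poly_Mapping.keys x \<union> Poly_Mapping.keys y"
  have fin: "finite ?A" by simp
  have *: "(\<Sum>k\<in>Poly_Mapping.keys z. F k (Poly_Mapping.lookup z k)) =
      (\<Sum>k\<in>?A. F k (Poly_Mapping.lookup z k))" if "Poly_Mapping.keys z \<subseteq> ?A" for z
    using fin that F0 by (intro pm_sum_superset) auto
  show ?thesis
    unfolding *[OF Poly_Mapping.keys_add] *[of x, OF Un_upper1] *[of y, OF Un_upper2]
    by (simp add: Fadd lookup_add sum.distrib)
qed

lemma pm_induct [case_names single add]:
  assumes "\<And>k c. P (Poly_Mapping.single k c)"
    and "\<And>x y. P x \<Longrightarrow> P y \<Longrightarrow> P (x + y)"
  shows "P (x :: 'a \<Rightarrow>\<^sub>0 'b::comm_monoid_add)"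
proof -
  have "P (\<Sum>k\<in>A. Poly_Mapping.single k (Poly_Mapping.lookup x k))" if "finite A" for A
    using that
  proof (induction A rule: finite_induct)
    case empty
    show ?case using assms(1)[of undefined 0] by simp
  next
    case (insert a A)
    then show ?case using assms by simp
  qed
  moreover have "(\<Sum>k\<in>Poly_Mapping.keys x. Poly_Mapping.single k (Poly_Mapping.lookup x k)) = x"
    by (rule poly_mapping_eqI)
       (simp add: lookup_sum lookup_single when_def Poly_Mapping.in_keys_iff)
  ultimately show ?thesis
    by (metis finite_keys)
qed

lemma qmul_alt:
  "qmul q x y = (\<Sum>k\<in>Poly_Mapping.keys x. \<Sum>l\<in>Poly_Mapping.keys y.
     Poly_Mapping.single (fst k + fst l, snd k + snd l)
       (Poly_Mapping.lookup x k * Poly_Mapping.lookup y l * q powi (snd k * fst l)))"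
  by (simp add: qmul_def case_prod_beta)

lemma qmul_add_left: "qmul q (x + y) z = qmul q x z + qmul q y z"
  unfolding qmul_alt
  by (rule pm_sum_add[where F = "\<lambda>k c. \<Sum>l\<in>Poly_Mapping.keys z. Poly_Mapping.single (fst k + fst l, snd k + snd l)
       (c * Poly_Mapping.lookup z l * q powi (snd k * fst l))"])
     (simp_all add: single_add distrib_right sum.distrib)

lemma qmul_add_right: "qmul q x (y + z) = qmul q x y + qmul q x z"
  unfolding qmul_alt sum.distrib[symmetric]
  by (rule sum.cong[OF refl], rule pm_sum_add)
     (simp_all add: single_add distrib_left distrib_right)

lemma qmul_single:
  "qmul q (Poly_Mapping.single (a, b) u) (Poly_Mapping.single (c, d) v) =
     Poly_Mapping.single (a + c, b + d) (u * v * q powi (b * c))"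
  by (simp add: qmul_def)

lemma qbar_add: "qbar q \<theta>1 \<theta>2 (x + y) = qbar q \<theta>1 \<theta>2 x + qbar q \<theta>1 \<theta>2 y"
  unfolding qbar_def case_prod_beta prod.collapse
  by (rule pm_sum_add[where F = "\<lambda>k c. Poly_Mapping.single k
       (c * (\<theta>1 powi fst k * \<theta>2 powi snd k * q powi (fst k * snd k)))"])
     (simp_all add: single_add distrib_right)

lemma qbar_single:
  "qbar q \<theta>1 \<theta>2 (Poly_Mapping.single (a, b) u) =
     Poly_Mapping.single (a, b) (u * (\<theta>1 powi a * \<theta>2 powi b * q powi (a * b)))"
  by (simp add: qbar_def)

lemma pm_scale_add:
  "Poly_Mapping.map ((*) (c::complex)) (x + y) = Poly_Mapping.map ((*) c) x + Poly_Mapping.map ((*) c) y"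
  by (rule poly_mapping_eqI) (auto simp: Poly_Mapping.map.rep_eq lookup_add when_def
      simp flip: distrib_left)

lemma pm_scale_single:
  "Poly_Mapping.map ((*) (c::complex)) (Poly_Mapping.single k u) = Poly_Mapping.single k (c * u)"
  by (rule poly_mapping_eqI) (simp add: Poly_Mapping.map.rep_eq lookup_single when_def)

lemma pm_scale_vector_space: "vector_space (\<lambda>c::complex. Poly_Mapping.map ((*) c))"
proof
  show "Poly_Mapping.map ((*) (a + b)) x = Poly_Mapping.map ((*) a) x + Poly_Mapping.map ((*) b) x"
    for a b :: complex and x :: "'a \<Rightarrow>\<^sub>0 complex"
    by (rule poly_mapping_eqI) (simp add: Poly_Mapping.map.rep_eq lookup_add when_def algebra_simps)
  show "Poly_Mapping.map ((*) a) (Poly_Mapping.map ((*) b) x) = Poly_Mapping.map ((*) (a * b)) x"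
    for a b :: complex and x :: "'a \<Rightarrow>\<^sub>0 complex"
    by (rule poly_mapping_eqI) (simp add: Poly_Mapping.map.rep_eq when_def)
  show "Poly_Mapping.map ((*) 1) x = x" for x :: "'a \<Rightarrow>\<^sub>0 complex"
    by (rule poly_mapping_eqI) (simp add: Poly_Mapping.map.rep_eq when_def)
qed (rule pm_scale_add)

lemma qtorus_unital:
  assumes "q \<noteq> 0"
  shows "unital_algebra (qtorus q \<theta>1 \<theta>2)"
proof (rule unital_algebra.intro)
  show "vector_space (scal (qtorus q \<theta>1 \<theta>2))"
    by (simp add: qtorus_def pm_scale_vector_space)
  fix x y z :: laurent2 and s :: complex
  have "qmul q (qmul q x y) z = qmul q x (qmul q y z)"
  proof (induction x rule: pm_induct)
    case (single k u)
    show ?case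
    proof (induction y rule: pm_induct)
      case (single l v)
      show ?case
      proof (induction z rule: pm_induct)
        case (single i w)
        show ?case using assms
          by (cases k; cases l; cases i)
             (simp add: qmul_single algebra_simps power_int_add)
      qed (simp add: qmul_add_left qmul_add_right)
    qed (simp add: qmul_add_left qmul_add_right)
  qed (simp add: qmul_add_left qmul_add_right)
  then show "amul (qtorus q \<theta>1 \<theta>2) (amul (qtorus q \<theta>1 \<theta>2) x y) z =
      amul (qtorus q \<theta>1 \<theta>2) x (amul (qtorus q \<theta>1 \<theta>2) y z)"
    by (simp add: qtorus_def)
  have "qmul q (Poly_Mapping.single (0, 0) 1) x = x"
  proof (induction x rule: pm_induct)
    case (single k u)
    show ?case by (cases k) (simp add: qmul_single)
  qed (simp add: qmul_add_right)
  then show "amul (qtorus q \<theta>1 \<theta>2) (aone (qtorus q \<theta>1 \<theta>2)) x = x"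
    by (simp add: qtorus_def)
  have "qmul q x (Poly_Mapping.single (0, 0) 1) = x"
  proof (induction x rule: pm_induct)
    case (single k u)
    show ?case by (cases k) (simp add: qmul_single)
  qed (simp add: qmul_add_left)
  then show "amul (qtorus q \<theta>1 \<theta>2) x (aone (qtorus q \<theta>1 \<theta>2)) = x"
    by (simp add: qtorus_def)
  show "amul (qtorus q \<theta>1 \<theta>2) (x + y) z =
      amul (qtorus q \<theta>1 \<theta>2) x z + amul (qtorus q \<theta>1 \<theta>2) y z"
    by (simp add: qtorus_def qmul_add_left)
  show "amul (qtorus q \<theta>1 \<theta>2) x (y + z) =
      amul (qtorus q \<theta>1 \<theta>2) x y + amul (qtorus q \<theta>1 \<theta>2) x z"
    by (simp add: qtorus_def qmul_add_right)
  have "qmul q (Poly_Mapping.map ((*) s) x) y = Poly_Mapping.map ((*) s) (qmul q x y) \<and>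
        qmul q x (Poly_Mapping.map ((*) s) y) = Poly_Mapping.map ((*) s) (qmul q x y)"
  proof (induction x rule: pm_induct)
    case (single k u)
    show ?case
    proof (induction y rule: pm_induct)
      case (single l v)
      show ?case
        by (cases k; cases l) (simp add: qmul_single pm_scale_single algebra_simps)
    qed (simp add: qmul_add_right pm_scale_add)
  qed (simp add: qmul_add_left pm_scale_add)
  then show "amul (qtorus q \<theta>1 \<theta>2) (scal (qtorus q \<theta>1 \<theta>2) s x) y =
      scal (qtorus q \<theta>1 \<theta>2) s (amul (qtorus q \<theta>1 \<theta>2) x y)"
    and "amul (qtorus q \<theta>1 \<theta>2) x (scal (qtorus q \<theta>1 \<theta>2) s y) =
      scal (qtorus q \<theta>1 \<theta>2) s (amul (qtorus q \<theta>1 \<theta>2) x y)"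
    by (simp_all add: qtorus_def)
qed

lemma powi_square_one:
  assumes "x \<in> {1, -1::complex}"
  shows "x powi k * x powi k = 1"
  using assms by (auto simp flip: power_int_mult_distrib)

lemma qtorus_involutive:
  assumes "q \<in> {1, -1}" "\<theta>1 \<in> {1, -1}" "\<theta>2 \<in> {1, -1}"
  shows "involutive_algebra (qtorus q \<theta>1 \<theta>2)"
proof -
  have nz: "q \<noteq> 0" "\<theta>1 \<noteq> 0" "\<theta>2 \<noteq> 0" using assms by auto
  interpret unital_algebra "qtorus q \<theta>1 \<theta>2" by (rule qtorus_unital[OF nz(1)])
  show ?thesis
  proof
    fix x y :: laurent2 and s :: complex
    show "bar (qtorus q \<theta>1 \<theta>2) (x + y) = bar (qtorus q \<theta>1 \<theta>2) x + bar (qtorus q \<theta>1 \<theta>2) y"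
      by (simp add: qtorus_def qbar_add)
    have "qbar q \<theta>1 \<theta>2 (Poly_Mapping.map ((*) s) x) =
        Poly_Mapping.map ((*) s) (qbar q \<theta>1 \<theta>2 x)"
    proof (induction x rule: pm_induct)
      case (single k u)
      show ?case by (cases k) (simp add: qbar_single pm_scale_single mult_ac)
    qed (simp add: qbar_add pm_scale_add)
    then show "bar (qtorus q \<theta>1 \<theta>2) (scal (qtorus q \<theta>1 \<theta>2) s x) =
        scal (qtorus q \<theta>1 \<theta>2) s (bar (qtorus q \<theta>1 \<theta>2) x)"
      by (simp add: qtorus_def)
    have "qbar q \<theta>1 \<theta>2 (qmul q x y) = qmul q (qbar q \<theta>1 \<theta>2 y) (qbar q \<theta>1 \<theta>2 x)"
    proof (induction x rule: pm_induct)
      case (single k u)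
      show ?case
      proof (induction y rule: pm_induct)
        case (single l v)
        obtain a b where k: "k = (a, b)" by (cases k)
        obtain c d where l: "l = (c, d)" by (cases l)
        have "q powi (b * c) * q powi ((a + c) * (b + d)) =
            (q powi (b * c) * q powi (b * c)) * (q powi (a * b) * q powi (c * d) * q powi (d * a))"
          using nz by (simp add: power_int_add algebra_simps)
        then have "q powi (b * c) * q powi ((a + c) * (b + d)) =
            q powi (a * b) * q powi (c * d) * q powi (d * a)"
          by (simp add: powi_square_one[OF assms(1)])
        then have *: "u * v * q powi (b * c) * (\<theta>1 powi (a + c) * \<theta>2 powi (b + d) * q powi ((a + c) * (b + d))) =
            v * (\<theta>1 powi c * \<theta>2 powi d * q powi (c * d)) * (u * (\<theta>1 powi a * \<theta>2 powi b * q powi (a * b))) * q powi (d * a)"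
          using nz by (simp add: power_int_add)
        show ?case unfolding k l qmul_single qbar_single * by (simp add: add.commute)
      qed (simp add: qmul_add_right qmul_add_left qbar_add)
    qed (simp add: qmul_add_left qmul_add_right qbar_add)
    then show "bar (qtorus q \<theta>1 \<theta>2) (amul (qtorus q \<theta>1 \<theta>2) x y) =
        amul (qtorus q \<theta>1 \<theta>2) (bar (qtorus q \<theta>1 \<theta>2) y) (bar (qtorus q \<theta>1 \<theta>2) x)"
      by (simp add: qtorus_def)
    have "qbar q \<theta>1 \<theta>2 (qbar q \<theta>1 \<theta>2 x) = x"
    proof (induction x rule: pm_induct)
      case (single k u)
      have "qbar q \<theta>1 \<theta>2 (qbar q \<theta>1 \<theta>2 (Poly_Mapping.single (a, b) u)) =
          Poly_Mapping.single (a, b) (u * ((\<theta>1 powi a * \<theta>1 powi a) * (\<theta>2 powi b * \<theta>2 powi b) *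
            (q powi (a * b) * q powi (a * b))))" for a b
        by (simp add: qbar_single mult_ac)
      then show ?case
        by (cases k) (simp add: powi_square_one[OF assms(1)] powi_square_one[OF assms(2)]
            powi_square_one[OF assms(3)])
    qed (simp add: qbar_add)
    then show "bar (qtorus q \<theta>1 \<theta>2) (bar (qtorus q \<theta>1 \<theta>2) x) = x"
      by (simp add: qtorus_def)
  qed
qed

lemma qtorus_relations:
  "amul (qtorus q \<theta>1 \<theta>2) t1 t1_inv = aone (qtorus q \<theta>1 \<theta>2)"
  "amul (qtorus q \<theta>1 \<theta>2) t1_inv t1 = aone (qtorus q \<theta>1 \<theta>2)"
  "amul (qtorus q \<theta>1 \<theta>2) t2 t2_inv = aone (qtorus q \<theta>1 \<theta>2)"
  "amul (qtorus q \<theta>1 \<theta>2) t2_inv t2 = aone (qtorus q \<theta>1 \<theta>2)"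
  "amul (qtorus q \<theta>1 \<theta>2) t2 t1 =
     scal (qtorus q \<theta>1 \<theta>2) q (amul (qtorus q \<theta>1 \<theta>2) t1 t2)"
  by (simp_all add: qtorus_def t1_def t2_def t1_inv_def t2_inv_def qmul_single pm_scale_single)

lemma qtorus_bar_generators:
  "bar (qtorus q \<theta>1 \<theta>2) t1 = scal (qtorus q \<theta>1 \<theta>2) \<theta>1 t1"
  "bar (qtorus q \<theta>1 \<theta>2) t2 = scal (qtorus q \<theta>1 \<theta>2) \<theta>2 t2"
  by (simp_all add: qtorus_def t1_def t2_def qbar_single pm_scale_single)


definition int_powers ::
    "('k, 's, 'm) alg_scheme \<Rightarrow> 's \<Rightarrow> 's \<Rightarrow> (int \<Rightarrow> 's) \<Rightarrow> bool" where
  "int_powers S x y P \<longleftrightarrow> P 0 = aone S \<and> P 1 = x \<and> P (-1) = y \<and>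
     (\<forall>a b. P (a + b) = amul S (P a) (P b))"

lemma unital_algebra_powers:
  fixes S :: "(complex, 's::ab_group_add, 'm) alg_scheme"
  assumes "unital_algebra S" and "amul S x y = aone S" and "amul S y x = aone S"
  shows "\<exists>P. int_powers S x y P"
proof -
  interpret unital_algebra S by fact
  define P where "P = (\<lambda>k::int. if k \<ge> 0 then apow S x (nat k) else apow S y (nat (- k)))"
  have ap: "apow S z (Suc i) = amul S z (apow S z i)" "apow S z 0 = aone S" for z i
    by (simp_all add: apow_def)
  have cancel: "amul S x (amul S y z) = z" "amul S y (amul S x z) = z" for z
    by (simp_all add: mul_assoc[symmetric] assms one_mul)
  have up: "P (k + 1) = amul S x (P k)" for k
  proof (cases "k \<ge> 0")
    case True
    then show ?thesis by (simp add: P_def nat_add_distrib ap)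
  next
    case False
    define i where "i = nat (- (k + 1))"
    have k: "k = - int i - 1" using False by (simp add: i_def)
    have "nat (- k) = Suc i" by (simp add: k)
    then have "amul S x (P k) = apow S y i" using False by (simp add: P_def ap cancel)
    also have "\<dots> = P (k + 1)" by (cases i) (simp_all add: k P_def ap nat_add_distrib)
    finally show ?thesis by simp
  qed
  have down: "P (k - 1) = amul S y (P k)" for k
    using up[of "k - 1"] cancel by simp
  have P0: "P 0 = aone S" by (simp add: P_def ap)
  have "P (a + b) = amul S (P a) (P b)" for a b
  proof (induction a rule: int_induct[of _ 0])
    case base
    show ?case by (simp add: P0 one_mul)
  next
    case (step1 i)
    have "P (i + 1 + b) = amul S x (P (i + b))" using up[of "i + b"] by (simp add: algebra_simps)
    then show ?case using step1 by (simp add: up mul_assoc)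
  next
    case (step2 i)
    have "P (i - 1 + b) = amul S y (P (i + b))" using down[of "i + b"] by (simp add: algebra_simps)
    then show ?case using step2 by (simp add: down mul_assoc)
  qed
  moreover have "P 1 = x" "P (-1) = y"
    using up[of 0] down[of 0] by (simp_all add: P0 mul_one)
  ultimately have "int_powers S x y P" using P0 by (simp add: int_powers_def)
  then show ?thesis by blast
qed

lemma qtorus_single:
  "Poly_Mapping.single (a, b) u =
     scal (qtorus q \<theta>1 \<theta>2) u (amul (qtorus q \<theta>1 \<theta>2) (Poly_Mapping.single (a, 0) 1) (Poly_Mapping.single (0, b) 1))"
  by (simp add: qtorus_def qmul_single pm_scale_single)

definition alg_hom ::
    "('k, 'r::ab_group_add, 'm) alg_scheme \<Rightarrow> ('k, 's::ab_group_add, 'l) alg_scheme \<Rightarrow> ('r \<Rightarrow> 's) \<Rightarrow> bool" where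
  "alg_hom R S \<phi> \<longleftrightarrow> (\<forall>x y. \<phi> (x + y) = \<phi> x + \<phi> y) \<and> (\<forall>c x. \<phi> (scal R c x) = scal S c (\<phi> x)) \<and>
     (\<forall>x y. \<phi> (amul R x y) = amul S (\<phi> x) (\<phi> y)) \<and> \<phi> (aone R) = aone S"

lemma qtorus_hom_single:
  fixes S :: "(complex, 's::ab_group_add, 'm) alg_scheme"
  assumes "unital_algebra S" and hom: "alg_hom (qtorus q \<theta>1 \<theta>2) S \<phi>"
    and P: "P 0 = aone S" "P 1 = \<phi> t1" "\<And>a b. P (a + b) = amul S (P a) (P b)"
    and Q: "Q 0 = aone S" "Q 1 = \<phi> t2" "\<And>a b. Q (a + b) = amul S (Q a) (Q b)"
  shows "\<phi> (Poly_Mapping.single (a, b) u) = scal S u (amul S (P a) (Q b))"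
proof -
  interpret unital_algebra S by fact
  let ?C = "qtorus q \<theta>1 \<theta>2"
  have h: "\<phi> (scal ?C c x) = scal S c (\<phi> x)" "\<phi> (amul ?C x y) = amul S (\<phi> x) (\<phi> y)"
    "\<phi> (aone ?C) = aone S" for c x y
    using hom by (auto simp: alg_hom_def)
  have powers: "E a = P a" if E0: "E 0 = aone S" and E1: "E 1 = P 1"
      and Eadd: "\<And>a b. E (a + b) = amul S (E a) (E b)"
      and P0: "P 0 = aone S" and Padd: "\<And>a b. P (a + b) = amul S (P a) (P b)"
    for E P :: "int \<Rightarrow> 's" and a
  proof -
    have "E (-1) = amul S (E (-1)) (amul S (P 1) (P (-1)))"
      using Padd[of 1 "-1"] by (simp add: P0 mul_one flip: Padd)
    also have "\<dots> = amul S (amul S (E (-1)) (E 1)) (P (-1))" by (simp add: mul_assoc E1)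
    also have "\<dots> = P (-1)" by (simp add: E0 one_mul flip: Eadd)
    finally have Em: "E (-1) = P (-1)" .
    show ?thesis
    proof (induction a rule: int_induct[of _ 0])
      case base
      show ?case by (simp add: E0 P0)
    next
      case (step1 i)
      then show ?case by (simp add: Eadd Padd E1)
    next
      case (step2 i)
      then show ?case using Eadd[of i "-1"] Padd[of i "-1"] by (simp add: Em)
    qed
  qed
  have "\<phi> (Poly_Mapping.single (a, 0) 1) = P a"
  proof (rule powers)
    show "\<phi> (Poly_Mapping.single (0, 0) 1) = aone S" using h(3) by (simp add: qtorus_def)
    show "\<phi> (Poly_Mapping.single (1, 0) 1) = P 1" by (simp add: P t1_def)
    show "\<phi> (Poly_Mapping.single (a + b, 0) 1) =
        amul S (\<phi> (Poly_Mapping.single (a, 0) 1)) (\<phi> (Poly_Mapping.single (b, 0) 1))" for a b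
      unfolding h(2)[symmetric] by (simp add: qtorus_def qmul_single)
  qed (use P in auto)
  moreover have "\<phi> (Poly_Mapping.single (0, b) 1) = Q b"
  proof (rule powers)
    show "\<phi> (Poly_Mapping.single (0, 0) 1) = aone S" using h(3) by (simp add: qtorus_def)
    show "\<phi> (Poly_Mapping.single (0, 1) 1) = Q 1" by (simp add: Q t2_def)
    show "\<phi> (Poly_Mapping.single (0, a + b) 1) =
        amul S (\<phi> (Poly_Mapping.single (0, a) 1)) (\<phi> (Poly_Mapping.single (0, b) 1))" for a b
      unfolding h(2)[symmetric] by (simp add: qtorus_def qmul_single)
  qed (use Q in auto)
  ultimately show ?thesis
    unfolding qtorus_single[of a b u q \<theta>1 \<theta>2] h by simp
qed

theorem qtorus_universal:
  fixes S :: "(complex, 's::ab_group_add, 'm) alg_scheme"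
  assumes q: "q \<noteq> 0" and S: "unital_algebra S"
    and x1: "amul S x1 y1 = aone S" "amul S y1 x1 = aone S"
    and x2: "amul S x2 y2 = aone S" "amul S y2 x2 = aone S"
    and rel: "amul S x2 x1 = scal S q (amul S x1 x2)"
  shows "\<exists>!\<phi>. alg_hom (qtorus q \<theta>1 \<theta>2) S \<phi> \<and> \<phi> t1 = x1 \<and> \<phi> t2 = x2"
proof -
  interpret unital_algebra S by fact
  interpret V: vector_space "scal S" by (rule vector_space)
  let ?C = "qtorus q \<theta>1 \<theta>2"
  obtain P where "int_powers S x1 y1 P"
    using unital_algebra_powers[OF S x1] by blast
  then have P: "P 0 = aone S" "P 1 = x1" "P (-1) = y1" "\<And>a b. P (a + b) = amul S (P a) (P b)"
    by (auto simp: int_powers_def)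
  obtain Q where "int_powers S x2 y2 Q"
    using unital_algebra_powers[OF S x2] by blast
  then have Q: "Q 0 = aone S" "Q 1 = x2" "Q (-1) = y2" "\<And>a b. Q (a + b) = amul S (Q a) (Q b)"
    by (auto simp: int_powers_def)
  have inv_comm: "amul S v z = scal S (inverse c) (amul S z v)"
    if "amul S u z = scal S c (amul S z u)" "amul S u v = aone S" "amul S v u = aone S" "c \<noteq> 0"
    for u v z c
  proof -
    have "amul S z v = amul S (amul S v (amul S u z)) v"
      by (simp add: mul_assoc[symmetric] that(3) one_mul)
    also have "\<dots> = scal S c (amul S v z)"
      by (simp add: that(1) scal_mul mul_scal mul_assoc that(2) mul_one)
    finally show ?thesis using that(4) by simp
  qed
  have inv_comm': "amul S z v = scal S (inverse c) (amul S v z)"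
    if "amul S z u = scal S c (amul S u z)" "amul S u v = aone S" "amul S v u = aone S" "c \<noteq> 0"
    for u v z c
  proof -
    have "amul S v z = amul S v (amul S (amul S z u) v)"
      by (simp add: mul_assoc that(2) mul_one)
    also have "\<dots> = scal S c (amul S z v)"
      by (simp add: that(1) scal_mul mul_scal mul_assoc[symmetric] that(3) one_mul)
    finally show ?thesis using that(4) by simp
  qed
  have comm1: "amul S x2 (P a) = scal S (q powi a) (amul S (P a) x2)" for a
  proof (induction a rule: int_induct[of _ 0])
    case base
    show ?case by (simp add: P one_mul mul_one)
  next
    case (step1 i)
    have "amul S x2 (P (i + 1)) = amul S (amul S x2 (P i)) x1" by (simp add: P mul_assoc)
    also have "\<dots> = scal S (q powi i) (amul S (P i) (amul S x2 x1))"
      by (simp add: step1 scal_mul mul_assoc)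
    finally show ?case
      using q by (simp add: rel mul_scal mul_assoc P power_int_add)
  next
    case (step2 i)
    have Pi: "P (i - 1) = amul S (P i) y1" using P(4)[of i "-1"] P(3) by simp
    have "amul S x2 (P (i - 1)) = amul S (amul S x2 (P i)) y1" by (simp add: Pi mul_assoc)
    also have "\<dots> = scal S (q powi i) (amul S (P i) (amul S x2 y1))"
      by (simp add: step2 scal_mul mul_assoc)
    also have "\<dots> = scal S (q powi i * inverse q) (amul S (P (i - 1)) x2)"
      by (simp add: inv_comm'[OF rel x1 q] mul_scal mul_assoc Pi)
    finally show ?case
      using q by (simp add: power_int_diff field_simps)
  qed
  have comm: "amul S (Q b) (P a) = scal S (q powi (b * a)) (amul S (P a) (Q b))" for a b
  proof (induction b rule: int_induct[of _ 0])
    case base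
    show ?case by (simp add: Q one_mul mul_one)
  next
    case (step1 i)
    have "amul S (Q (i + 1)) (P a) = amul S (Q i) (amul S x2 (P a))" by (simp add: Q mul_assoc)
    also have "\<dots> = scal S (q powi a) (amul S (amul S (Q i) (P a)) x2)"
      by (simp add: comm1 mul_scal mul_assoc)
    also have "\<dots> = scal S (q powi a * q powi (i * a)) (amul S (P a) (Q (i + 1)))"
      by (simp add: step1 scal_mul mul_assoc Q)
    finally show ?case
      using q by (simp add: power_int_add distrib_left distrib_right mult.commute)
  next
    case (step2 i)
    have Qi: "Q (i - 1) = amul S (Q i) y2" using Q(4)[of i "-1"] Q(3) by simp
    have qa: "q powi a \<noteq> 0" using q by simp
    have "amul S (Q (i - 1)) (P a) = amul S (Q i) (amul S y2 (P a))" by (simp add: Qi mul_assoc)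
    also have "\<dots> = scal S (inverse (q powi a)) (amul S (amul S (Q i) (P a)) y2)"
      by (simp add: inv_comm[OF comm1 x2 qa] mul_scal mul_assoc)
    also have "\<dots> = scal S (inverse (q powi a) * q powi (i * a)) (amul S (P a) (Q (i - 1)))"
      by (simp add: step2 scal_mul mul_assoc Qi)
    finally show ?case
      using q by (simp add: power_int_diff left_diff_distrib field_simps)
  qed
  define \<phi> where "\<phi> = (\<lambda>x::laurent2. \<Sum>k\<in>Poly_Mapping.keys x.
    scal S (Poly_Mapping.lookup x k) (amul S (P (fst k)) (Q (snd k))))"
  have \<phi>_single: "\<phi> (Poly_Mapping.single (a, b) u) = scal S u (amul S (P a) (Q b))" for a b u
    by (simp add: \<phi>_def)
  have \<phi>_add: "\<phi> (x + y) = \<phi> x + \<phi> y" for x y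
    unfolding \<phi>_def
    by (rule pm_sum_add[where F = "\<lambda>k c. scal S c (amul S (P (fst k)) (Q (snd k)))"])
       (simp_all add: V.scale_left_distrib)
  have \<phi>_scal: "\<phi> (scal ?C c x) = scal S c (\<phi> x)" for c x
  proof (induction x rule: pm_induct)
    case (single k u)
    show ?case by (cases k) (simp add: qtorus_def pm_scale_single \<phi>_single)
  next
    case (add x y)
    then show ?case by (simp add: qtorus_def pm_scale_add \<phi>_add V.scale_right_distrib)
  qed
  have \<phi>_mul: "\<phi> (amul ?C x y) = amul S (\<phi> x) (\<phi> y)" for x y
  proof (induction x rule: pm_induct)
    case (single k u)
    show ?case
    proof (induction y rule: pm_induct)
      case (single l v)
      obtain a b where k: "k = (a, b)" by (cases k)
      obtain c d where l: "l = (c, d)" by (cases l)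
      have "amul S (amul S (P a) (Q b)) (amul S (P c) (Q d)) =
          amul S (P a) (amul S (amul S (Q b) (P c)) (Q d))" by (simp add: mul_assoc)
      also have "\<dots> = scal S (q powi (b * c)) (amul S (P (a + c)) (Q (b + d)))"
        by (simp add: comm scal_mul mul_scal mul_assoc P(4) Q(4))
      finally show ?case
        unfolding k l by (simp add: qtorus_def qmul_single \<phi>_single scal_mul mul_scal mult_ac)
    next
      case (add x y)
      then show ?case by (simp add: qtorus_def qmul_add_right \<phi>_add mul_add)
    qed
  next
    case (add x y)
    then show ?case by (simp add: qtorus_def qmul_add_left \<phi>_add add_mul)
  qed
  have "\<phi> (aone ?C) = aone S" by (simp add: qtorus_def \<phi>_single P Q one_mul)
  then have "alg_hom ?C S \<phi>" by (simp add: alg_hom_def \<phi>_add \<phi>_scal \<phi>_mul)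
  moreover have "\<phi> t1 = x1" "\<phi> t2 = x2"
    by (simp_all add: t1_def t2_def \<phi>_single P Q one_mul mul_one)
  moreover have "\<psi> = \<phi>" if "alg_hom ?C S \<psi> \<and> \<psi> t1 = x1 \<and> \<psi> t2 = x2" for \<psi>
  proof
    fix x
    show "\<psi> x = \<phi> x"
    proof (induction x rule: pm_induct)
      case (single k u)
      obtain a b where k: "k = (a, b)" by (cases k)
      have "\<psi> (Poly_Mapping.single (a, b) u) = scal S u (amul S (P a) (Q b))"
        using that by (intro qtorus_hom_single[OF S, of q \<theta>1 \<theta>2]) (simp_all add: P Q)
      then show ?case by (simp add: k \<phi>_single)
    next
      case (add x y)
      then show ?case using that by (simp add: alg_hom_def \<phi>_add)
    qed
  qed
  ultimately show ?thesis by blast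
qed

theorem qtorus_bar_unique:
  assumes q: "q \<in> {1, -1}" "\<theta>1 \<in> {1, -1}" "\<theta>2 \<in> {1, -1}"
    and inv: "involutive_algebra ((qtorus q \<theta>1 \<theta>2) \<lparr>bar := \<beta>\<rparr>)"
    and gens: "\<beta> t1 = scal (qtorus q \<theta>1 \<theta>2) \<theta>1 t1" "\<beta> t2 = scal (qtorus q \<theta>1 \<theta>2) \<theta>2 t2"
  shows "\<beta> = bar (qtorus q \<theta>1 \<theta>2)"
proof -
  let ?C = "qtorus q \<theta>1 \<theta>2"
  interpret C: involutive_algebra ?C by (rule qtorus_involutive[OF q])
  interpret B: involutive_algebra "?C\<lparr>bar := \<beta>\<rparr>" by (rule inv)
  have q0: "q \<noteq> 0" using q by auto
  have \<beta>: "\<beta> (x + y) = \<beta> x + \<beta> y" "\<beta> (scal ?C c x) = scal ?C c (\<beta> x)"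
    "\<beta> (amul ?C x y) = amul ?C (\<beta> y) (\<beta> x)" "\<beta> (\<beta> x) = x" for x y c
    using B.bar_add[of x y] B.bar_scal[of c x] B.bar_mul[of x y] B.bar_bar[of x] by simp_all
  have hom: "alg_hom ?C ?C (\<lambda>x. bar ?C (\<beta> x))"
  proof -
    have one: "amul ?C (bar ?C (\<beta> (aone ?C))) x = x" for x
    proof -
      have "bar ?C (\<beta> (amul ?C (aone ?C) (\<beta> (bar ?C x)))) = amul ?C (bar ?C (\<beta> (aone ?C))) x"
        by (simp only: \<beta> C.bar_mul C.bar_bar)
      then show ?thesis by (simp only: C.one_mul \<beta> C.bar_bar)
    qed
    have "bar ?C (\<beta> (aone ?C)) = aone ?C" using one[of "aone ?C"] by (simp only: C.mul_one)
    then show ?thesis by (simp add: alg_hom_def \<beta> C.bar_add C.bar_scal C.bar_mul)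
  qed
  interpret V: vector_space "scal ?C" by (rule C.vector_space)
  have sq: "\<theta>1 * \<theta>1 = 1" "\<theta>2 * \<theta>2 = 1" using q by auto
  have g1: "bar ?C (\<beta> t1) = t1"
    by (simp only: gens C.bar_scal qtorus_bar_generators V.scale_scale sq V.scale_one)
  have g2: "bar ?C (\<beta> t2) = t2"
    by (simp only: gens C.bar_scal qtorus_bar_generators V.scale_scale sq V.scale_one)
  have id: "alg_hom ?C ?C (\<lambda>x. x)" by (simp add: alg_hom_def)
  have "(\<lambda>x. bar ?C (\<beta> x)) = (\<lambda>x. x)"
    using qtorus_universal[OF q0 C.unital_algebra_axioms, of t1 t1_inv t2 t2_inv \<theta>1 \<theta>2]
      hom id g1 g2 qtorus_relations by blast
  then have "bar ?C (\<beta> x) = x" for x by meson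
  then show ?thesis by (metis C.bar_bar ext)
qed

lemma mult_order_values: "mult_order 1 = 1" "mult_order (-1) = 2"
proof -
  show "mult_order 1 = 1" unfolding mult_order_def by (rule Least_equality) auto
  have "m \<ge> 2" if "m > 0" "(-1 :: complex) ^ m = 1" for m
    using that by (cases "m = 1") auto
  then show "mult_order (-1) = 2" unfolding mult_order_def by (intro Least_equality) auto
qed

end

theory Submission
  imports Defs
begin

text \<open>Write \<open>L\<close> for the Lie algebra, \<open>R\<close> for the quantum torus and \<open>c = t\<^sub>i\<^sup>m\<close>, a central unit. As
  \<open>L/\<J>\<close> is finite-dimensional, \<open>f\<^sub>1\<^sub>2(p(c)) \<in> \<J>\<close> for some \<open>p \<noteq> 0\<close>. Let \<open>r\<close> be squarefree, invariant
  under \<open>T \<mapsto> \<theta>\<^sub>i\<^sup>m T\<close>, with \<open>r(0) \<noteq> 0\<close> and vanishing at the nonzero roots of \<open>p\<close>. Then \<open>z = r(c)\<close> is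
  central and symmetric, and \<open>f\<^sub>1\<^sub>2(z\<^sup>N) \<in> \<J>\<close> for some \<open>N\<close>. Multiplication by \<open>z\<close> preserves \<open>L\<close> and is
  linear for the bracket, and \<open>f\<^sub>1\<^sub>2(1)\<close> generates \<open>L\<close> as an ideal, so \<open>z\<^sup>N L \<subseteq> \<J>\<close>. The image of the
  ideal \<open>z L\<close> in \<open>L/\<J>\<close> is therefore solvable, and semisimplicity gives \<open>z L \<subseteq> \<J>\<close>. Doing this for both
  generators yields \<open>z\<close> and \<open>w\<close> with \<open>J(f,g) = z R + w R\<close>, and the inclusion follows. For the equality
  of the two subalgebras, every \<open>x \<in> J\<close> is congruent modulo \<open>[J,R]\<close> to its central part (an average over
  conjugations by \<open>t\<^sub>1\<close> and \<open>t\<^sub>2\<close>), which lies in \<open>J\<close> and is symmetric if \<open>x \<in> R\<^sub>+ + [R,R]\<close>.\<close>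

section \<open>Linear algebra and polynomials\<close>

text \<open>A projection \<open>g\<close> with kernel exactly \<open>J\<close> sends every
  \<open>v k\<close> into the span of the image of the finite set \<open>B\<close>. Enough vectors
  there are linearly related, and the same combination of the \<open>v k\<close> lies in the
  kernel.\<close>

lemma (in vector_space) finite_codim_dependent:
  assumes J: "subspace J" and B: "finite B" and v: "\<And>k::nat. v k \<in> span (B \<union> J)"
  shows "\<exists>u N. (\<exists>k\<le>N. u k \<noteq> 0) \<and> (\<Sum>k\<le>N. u k *s v k) \<in> J"
proof -
  interpret P: vector_space_pair scale scale by unfold_locales
  obtain C where C: "C \<subseteq> J" "independent C" "J \<subseteq> span C"
    using maximal_independent_subset[of J] by blast
  define D where "D = extend_basis C"
  have D: "C \<subseteq> D" "independent D" "span D = UNIV"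
    using extend_basis_superset independent_extend_basis span_extend_basis C(2)
    by (auto simp: D_def)
  \<comment> \<open>\<open>D\<close> extends a basis \<open>C\<close> of \<open>J\<close>; killing
    \<open>C\<close> and fixing the other basis vectors projects along \<open>J\<close> onto a
    complement.\<close>
  obtain g where g: "Vector_Spaces.linear scale scale g"
      "\<And>x. x \<in> D \<Longrightarrow> g x = (if x \<in> C then 0 else x)"
    using P.linear_independent_extend[OF D(2), of "\<lambda>x. if x \<in> C then 0 else x"] by blast
  interpret g: Vector_Spaces.linear scale scale g by (rule g(1))
  have g0: "g x = 0" if "x \<in> J" for x
    by (rule P.linear_eq_0_on_span[OF g(1), of C]) (use g(2) D(1) C(3) that in auto)
  have ker: "x \<in> J" if "g x = 0" for x
  proof -
    have "x \<in> span (C \<union> (D - C))" using D by (metis Un_Diff_cancel UNIV_I Un_absorb1)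
    then obtain y w where x: "x = y + w" "y \<in> span C" "w \<in> span (D - C)"
      unfolding span_Un by blast
    have y: "y \<in> J" using x(2) span_minimal[OF C(1) J] by blast
    have "g w = id w"
      by (rule P.linear_eq_on_span[OF g(1) linear_id _ x(3)]) (use g(2) in auto)
    then have "w = 0" using that g0[OF y] by (simp add: x(1) g.add)
    then show ?thesis using x y by simp
  qed
  have gv: "g (v k) \<in> span (g ` B)" for k
  proof -
    obtain a b where ab: "v k = a + b" "a \<in> span B" "b \<in> span J"
      using v[of k] unfolding span_Un by blast
    have "b \<in> J" using ab(3) span_minimal[OF order.refl J] by blast
    then have "g (v k) = g a" by (simp add: ab(1) g.add g0)
    then show ?thesis using ab(2) by (auto simp: g.span_image)
  qed
  define N where "N = card (g ` B)"
  have "\<exists>u. (\<exists>k\<le>N. u k \<noteq> 0) \<and> (\<Sum>k\<le>N. u k *s g (v k)) = 0"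
  \<comment> \<open>Dependence is a property of sets and does not see repetitions. A repeated vector
    gives the relation by itself; otherwise \<open>N + 1\<close> distinct vectors lie in the span of
    \<open>N\<close> elements.\<close>
  proof (cases "inj_on (\<lambda>k. g (v k)) {..N}")
    case False
    then obtain i j where ij: "i \<le> N" "j \<le> N" "i \<noteq> j" "g (v i) = g (v j)"
      by (auto simp: inj_on_def)
    let ?u = "\<lambda>k. (if k = i then 1 else 0) - (if k = j then 1 else (0::'a))"
    have "(\<Sum>k\<le>N. ?u k *s g (v k)) =
        (\<Sum>k\<le>N. if k = i then g (v k) else 0) - (\<Sum>k\<le>N. if k = j then g (v k) else 0)"
      unfolding sum_subtractf[symmetric]
      by (rule sum.cong) (auto simp: scale_left_diff_distrib)
    also have "\<dots> = 0" using ij by simp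
    finally have "(\<Sum>k\<le>N. ?u k *s g (v k)) = 0" .
    moreover have "?u i \<noteq> 0" using ij by simp
    ultimately show ?thesis using ij(1) by (intro exI[of _ ?u]) blast
  next
    case True
    let ?S = "(\<lambda>k. g (v k)) ` {..N}"
    have "card ?S = Suc N" using True by (simp add: card_image)
    then have "dependent ?S"
      using independent_span_bound[of "g ` B" ?S] B gv by (force simp: N_def)
    then obtain u where u: "\<exists>x\<in>?S. u x \<noteq> 0" "(\<Sum>x\<in>?S. u x *s x) = 0"
      by (subst (asm) dependent_finite) auto
    have "(\<Sum>k\<le>N. u (g (v k)) *s g (v k)) = 0"
      using u(2) by (simp add: sum.reindex[OF True])
    then show ?thesis using u(1) by (intro exI[of _ "\<lambda>k. u (g (v k))"]) auto
  qed
  then obtain u where u: "\<exists>k\<le>N. u k \<noteq> 0" "(\<Sum>k\<le>N. u k *s g (v k)) = 0" by blast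
  have "g (\<Sum>k\<le>N. u k *s v k) = 0" using u(2) by (simp add: g.sum g.scale)
  then show ?thesis using ker u(1) by blast
qed

text \<open>\<open>f\<close> is the product of distinct linear factors over a set of nonzero points
  that contains the nonzero roots of \<open>p\<close> and is stable under \<open>\<theta>\<close>.
  The factor \<open>[:0, 1:]\<close> accounts for a possible root 0 of \<open>p\<close>.\<close>

lemma exists_squarefree_symmetric_poly:
  fixes p :: "complex poly"
  assumes p: "p \<noteq> 0" and \<theta>: "\<theta> \<in> {1, -1}"
  shows "\<exists>f N. poly f 0 \<noteq> 0 \<and> degree f > 0 \<and> gcd f (pderiv f) = 1 \<and>
    pcompose f [:0, \<theta>:] = f \<and> p dvd ([:0, 1:] * f) ^ N"
proof -
  \<comment> \<open>The root 0 is removed to get \<open>poly f 0 \<noteq> 0\<close>; the point 1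
    keeps the degree positive when \<open>p\<close> has no nonzero root. Since
    \<open>\<theta> * \<theta> = 1\<close>, one translate makes \<open>S\<close> stable.\<close>
  define S0 where "S0 = insert 1 ({x. poly p x = 0} - {0})"
  define S where "S = S0 \<union> (*) \<theta> ` S0"
  define f where "f = (\<Prod>x\<in>S. [:-x, 1:])"
  have \<theta>2: "\<theta> * \<theta> = 1" "\<theta> \<noteq> 0" using \<theta> by auto
  have fin: "finite S" using poly_roots_finite[OF p] by (simp add: S_def S0_def)
  have S0: "0 \<notin> S" "1 \<in> S" using \<theta>2 by (auto simp: S_def S0_def)
  have img: "(*) \<theta> ` S = S"
    by (auto simp: S_def image_Un image_image mult.assoc[symmetric] \<theta>2)
  have roots: "poly f x = 0 \<longleftrightarrow> x \<in> S" for x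
    using fin by (auto simp: f_def poly_prod)
  have f0: "f \<noteq> 0" using fin by (auto simp: f_def)
  have deg: "degree f = card S" using fin by (simp add: f_def degree_prod_eq_sum_degree)
  have "card S > 0" using fin S0 by (auto simp: card_gt_0_iff)
  have simple: "\<not> (poly f x = 0 \<and> poly (pderiv f) x = 0)" for x
  proof
    assume *: "poly f x = 0 \<and> poly (pderiv f) x = 0"
    then have x: "x \<in> S" using roots by blast
    let ?h = "\<Prod>y\<in>S - {x}. [:-y, 1:]"
    have "f = [:-x, 1:] * ?h" using fin x by (simp add: f_def prod.remove)
    then have "pderiv f = [:-x, 1:] * pderiv ?h + ?h * pderiv [:-x, 1:]"
      by (metis pderiv_mult)
    then have "poly ?h x = 0" using * by (simp add: pderiv_pCons)
    then show False using fin by (auto simp: poly_prod)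
  qed
  have "gcd f (pderiv f) = 1"
  proof (rule ccontr)
    \<comment> \<open>Over the complex numbers a nontrivial gcd has a root, which would be a
      multiple root of \<open>f\<close>.\<close>
    assume "gcd f (pderiv f) \<noteq> 1"
    then have "\<not> is_unit (gcd f (pderiv f))" by (simp add: is_unit_gcd_iff)
    moreover have nz: "gcd f (pderiv f) \<noteq> 0" using f0 by simp
    ultimately have "degree (gcd f (pderiv f)) \<noteq> 0" using is_unit_iff_degree by blast
    then have "\<not> constant (poly (gcd f (pderiv f)))" by (simp add: constant_degree)
    then obtain x where "poly (gcd f (pderiv f)) x = 0"
      using fundamental_theorem_of_algebra by blast
    then have "[:-x, 1:] dvd gcd f (pderiv f)" by (simp add: poly_eq_0_iff_dvd)
    then have "[:-x, 1:] dvd f" "[:-x, 1:] dvd pderiv f"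
      using dvd_trans gcd_dvd1 gcd_dvd2 by blast+
    then show False using simple[of x] by (simp add: poly_eq_0_iff_dvd)
  qed
  moreover have "pcompose f [:0, \<theta>:] = f"
  proof -
    have "pcompose f [:0, \<theta>:] = (\<Prod>x\<in>(*) \<theta> ` S. [:-x, \<theta>:])"
      by (simp add: img f_def pcompose_prod pcompose_pCons)
    \<comment> \<open>Reindexing by \<open>\<theta> * x\<close> pulls the scalar
      \<open>\<theta>\<close> out of each factor.\<close>
    also have "\<dots> = (\<Prod>x\<in>S. smult \<theta> [:-x, 1:])"
      by (subst prod.reindex) (use \<theta>2 in \<open>auto simp: inj_on_def\<close>)
    also have "\<dots> = smult (\<theta> ^ card S) f"
      by (simp only: prod_smult f_def prod_constant)
    finally have eq: "pcompose f [:0, \<theta>:] = smult (\<theta> ^ card S) f" .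
    \<comment> \<open>Evaluating at \<open>0\<close>, which is not a root, shows that the sign is trivial.\<close>
    have "poly (pcompose f [:0, \<theta>:]) 0 = poly f 0" by (simp add: poly_pcompose)
    then have "\<theta> ^ card S = 1" using eq S0 roots[of 0] by simp
    then show ?thesis using eq by simp
  qed
  moreover have "p dvd ([:0, 1:] * f) ^ degree p"
  proof -
    \<comment> \<open>Over an algebraically closed field, inclusion of root sets gives divisibility
      of a power.\<close>
    have "\<forall>x. poly p x = 0 \<longrightarrow> poly ([:0, 1:] * f) x = 0"
      using roots by (auto simp: S_def S0_def)
    then show ?thesis using p nullstellensatz_univariate[of p "[:0, 1:] * f"] by blast
  qed
  ultimately show ?thesis using roots[of 0] S0 deg \<open>card S > 0\<close> by auto
qed

section \<open>Polynomials in an element of an algebra\<close>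

sublocale unital_algebra \<subseteq> V: vector_space "scal R"
  by (rule vector_space)

context unital_algebra
begin

abbreviation times_R (infixl \<open>\<odot>\<close> 70) where "a \<odot> b \<equiv> amul R a b"

lemma zero_mul [simp]: "0 \<odot> a = 0"
  using add_mul[of 0 0 a] by simp

lemma mul_zero [simp]: "a \<odot> 0 = 0"
  using mul_add[of a 0 0] by simp

lemma diff_mul: "(a - b) \<odot> c = a \<odot> c - b \<odot> c"
  using add_mul[of "a - b" b c] by (simp add: algebra_simps)

lemma mul_diff: "a \<odot> (b - c) = a \<odot> b - a \<odot> c"
  using mul_add[of a "b - c" c] by (simp add: algebra_simps)

lemma mul_sum: "a \<odot> (\<Sum>i\<in>A. h i) = (\<Sum>i\<in>A. a \<odot> h i)"
  by (induction A rule: infinite_finite_induct) (simp_all add: mul_add)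

lemma apow_0 [simp]: "apow R x 0 = aone R"
  and apow_Suc: "apow R x (Suc k) = x \<odot> apow R x k"
  by (simp_all add: apow_def)

lemma apow_add: "apow R x (j + k) = apow R x j \<odot> apow R x k"
  by (induction j) (simp_all add: apow_Suc one_mul mul_assoc)

lemma apow_Suc_right: "apow R x (Suc k) = apow R x k \<odot> x"
  using apow_add[of x k 1] by (simp add: apow_Suc mul_one)

lemma apow_left_inverse:
  assumes "y \<odot> x = aone R"
  shows "apow R y k \<odot> apow R x k = aone R"
proof (induction k)
  case (Suc k)
  have "apow R y (Suc k) \<odot> apow R x (Suc k) = apow R y k \<odot> (y \<odot> x) \<odot> apow R x k"
    by (simp add: apow_Suc_right[of y] apow_Suc[of x] mul_assoc)
  then show ?case using Suc by (simp add: assms mul_one)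
qed (simp add: one_mul)

lemma apoly_eq_sum:
  assumes "degree p \<le> N"
  shows "apoly R p x = (\<Sum>i\<le>N. scal R (coeff p i) (apow R x i))"
  unfolding apoly_def
  by (rule sum.mono_neutral_left) (use assms in \<open>auto simp: coeff_eq_0\<close>)

lemma apoly_0 [simp]: "apoly R 0 x = 0"
  by (simp add: apoly_def)

lemma apoly_add: "apoly R (p + p') x = apoly R p x + apoly R p' x"
proof -
  let ?N = "max (degree p) (degree p')"
  show ?thesis
    using degree_add_le_max[of p p']
    by (simp add: apoly_eq_sum[of _ ?N] V.scale_left_distrib sum.distrib)
qed

lemma apoly_smult: "apoly R (smult a p) x = scal R a (apoly R p x)"
  by (simp add: apoly_eq_sum[of "smult a p" "degree p"] apoly_def V.scale_sum_right degree_smult_le)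

lemma apoly_pCons: "apoly R (pCons a p) x = scal R a (aone R) + x \<odot> apoly R p x"
proof -
  have "apoly R (pCons a p) x =
      (\<Sum>i\<le>Suc (degree p). scal R (coeff (pCons a p) i) (apow R x i))"
    by (rule apoly_eq_sum) (simp add: degree_pCons_le)
  also have "\<dots> = scal R a (aone R) + x \<odot> apoly R p x"
    by (simp add: sum.atMost_Suc_shift apow_Suc apoly_def mul_sum mul_scal del: sum.atMost_Suc)
  finally show ?thesis .
qed

lemma apoly_mult: "apoly R (p * p') x = apoly R p x \<odot> apoly R p' x"
  by (induction p)
     (simp_all add: apoly_add apoly_smult apoly_pCons add_mul scal_mul one_mul mul_assoc)

lemma apoly_1: "apoly R 1 x = aone R"
  by (simp add: one_pCons apoly_pCons)

lemma apoly_power: "apoly R (p ^ k) x = apow R (apoly R p x) k"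
  by (induction k) (simp_all add: apoly_1 apoly_mult apow_Suc)

lemma apoly_X: "apoly R [:0, 1:] x = x"
  by (simp add: apoly_pCons mul_one)

lemma apoly_commute: "apoly R p x \<odot> x = x \<odot> apoly R p x"
  using apoly_mult[of p "[:0, 1:]" x] apoly_mult[of "[:0, 1:]" p x]
  by (simp only: apoly_X mult.commute)

text \<open>When \<open>bar R x = scal R c x\<close>, this turns invariance of a polynomial under
  scaling its variable into symmetry of its value at \<open>x\<close>.\<close>

lemma apoly_pcompose_scale: "apoly R (pcompose p [:0, c:]) x = apoly R p (scal R c x)"
  by (induction p)
     (simp_all add: pcompose_pCons apoly_add apoly_pCons apoly_mult apoly_smult
       scal_mul mul_scal mul_one)

lemma apoly_central:
  assumes "\<And>a. x \<odot> a = a \<odot> x"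
  shows "apoly R p x \<odot> a = a \<odot> apoly R p x"
proof (induction p)
  case (pCons c p)
  have "x \<odot> apoly R p x \<odot> a = x \<odot> (a \<odot> apoly R p x)" by (simp add: mul_assoc pCons)
  also have "\<dots> = a \<odot> (x \<odot> apoly R p x)" by (metis mul_assoc assms)
  finally show ?case
    by (simp add: apoly_pCons add_mul mul_add scal_mul mul_scal one_mul mul_one)
qed simp

lemma alg_ideal_gen_ideal: "alg_ideal R (gen_ideal R S)"
  unfolding alg_ideal_def gen_ideal_def
  by (auto simp: alg_ideal_def intro: V.subspace_Inter)

lemma gen_ideal_minimal: "alg_ideal R J \<Longrightarrow> S \<subseteq> J \<Longrightarrow> gen_ideal R S \<subseteq> J"
  by (auto simp: gen_ideal_def)

end

section \<open>Matrices over an algebra with involution\<close>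

sublocale unital_algebra \<subseteq> M: vector_space "mat_scal R"
  by unfold_locales
     (auto simp: mat_scal_def fun_eq_iff V.scale_right_distrib V.scale_left_distrib)

context unital_algebra
begin

lemma mat_mul_diff_left: "mat_mul R N (A - B) C = mat_mul R N A C - mat_mul R N B C"
  by (simp add: mat_mul_def fun_eq_iff diff_mul sum_subtractf)

lemma mat_mul_diff_right: "mat_mul R N C (A - B) = mat_mul R N C A - mat_mul R N C B"
  by (simp add: mat_mul_def fun_eq_iff mul_diff sum_subtractf)

lemma mat_scal_emat: "mat_scal R c (emat i j a) = emat i j (scal R c a)"
  by (auto simp: mat_scal_def emat_def fun_eq_iff)

lemma emat_add: "emat i j (a + b) = emat i j a + emat i j b"
  and emat_diff: "emat i j (a - b) = emat i j a - emat i j b"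
  for a b :: 'r
  by (auto simp: emat_def fun_eq_iff)

lemma emat_uminus: "emat i j (- a) = - emat i j a" for a :: 'r
  by (auto simp: emat_def fun_eq_iff)

lemma mat_mul_emat:
  assumes "j \<in> {1..N}"
  shows "mat_mul R N (emat i j a) (emat k l b) = (if j = k then emat i l (a \<odot> b) else 0)"
proof (intro ext)
  fix i' l'
  have "mat_mul R N (emat i j a) (emat k l b) i' l' =
      (\<Sum>s=1..N. if s = j then (if i' = i \<and> j = k \<and> l' = l then a \<odot> b else 0) else 0)"
    unfolding mat_mul_def by (rule sum.cong) (auto simp: emat_def)
  also have "\<dots> = (if i' = i \<and> j = k \<and> l' = l then a \<odot> b else 0)"
    using assms by simp
  finally show "mat_mul R N (emat i j a) (emat k l b) i' l' =
      (if j = k then emat i l (a \<odot> b) else 0) i' l'"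
    by (auto simp: emat_def)
qed

text \<open>For central symmetric \<open>z\<close> this acts as a scalar: it preserves
  \<open>L\<close> and is linear for the bracket. It is the operator that forms the ideals
  \<open>z L\<close>.\<close>

definition mat_lmul :: "'r \<Rightarrow> 'r matr \<Rightarrow> 'r matr" where
  "mat_lmul z A = (\<lambda>i j. z \<odot> A i j)"

lemma mat_lmul_add: "mat_lmul z (A + B) = mat_lmul z A + mat_lmul z B"
  and mat_lmul_diff: "mat_lmul z (A - B) = mat_lmul z A - mat_lmul z B"
  and mat_lmul_scal: "mat_lmul z (mat_scal R c A) = mat_scal R c (mat_lmul z A)"
  and mat_lmul_mul: "mat_lmul (z \<odot> w) A = mat_lmul z (mat_lmul w A)"
  and mat_lmul_zero: "mat_lmul z 0 = 0"
  and mat_lmul_emat: "mat_lmul z (emat i j a) = emat i j (z \<odot> a)"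
  by (auto simp: mat_lmul_def mat_scal_def emat_def fun_eq_iff mul_add mul_diff mul_scal
      mul_assoc one_mul)

lemma mat_mul_lmul_left: "mat_mul R N (mat_lmul z A) B = mat_lmul z (mat_mul R N A B)"
  by (simp add: mat_mul_def mat_lmul_def fun_eq_iff mul_assoc mul_sum)

lemma mat_mul_lmul_right:
  assumes "\<And>a. z \<odot> a = a \<odot> z"
  shows "mat_mul R N A (mat_lmul z B) = mat_lmul z (mat_mul R N A B)"
proof -
  have "a \<odot> (z \<odot> b) = z \<odot> (a \<odot> b)" for a b by (metis mul_assoc assms)
  then show ?thesis by (simp add: mat_mul_def mat_lmul_def fun_eq_iff mul_sum)
qed

end

context involutive_algebra
begin

lemma bar_zero [simp]: "bar R 0 = 0"
  using bar_add[of 0 0] by simp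

lemma bar_uminus: "bar R (- a) = - bar R a"
  using bar_add[of a "- a"] by (simp add: eq_neg_iff_add_eq_0 add.commute)

lemma bar_diff: "bar R (a - b) = bar R a - bar R b"
  using bar_add[of a "- b"] by (simp add: bar_uminus)

lemma bar_one [simp]: "bar R (aone R) = aone R"
  by (metis bar_bar bar_mul mul_one)

lemma bar_apoly: "bar R (apoly R p x) = apoly R p (bar R x)"
  by (induction p) (simp_all add: apoly_pCons bar_add bar_scal bar_mul apoly_commute)

text \<open>Centrality lets \<open>mat_lmul z\<close> pass through brackets; together with symmetry
  it gives \<open>bar R (z \<odot> a) = z \<odot> bar R a\<close>, so that \<open>mat_lmul z\<close>
  acts on the argument of a root element.\<close>

definition central_symmetric :: "'r \<Rightarrow> bool" where
  "central_symmetric z \<longleftrightarrow> (\<forall>a. z \<odot> a = a \<odot> z) \<and> bar R z = z"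

lemma central_symmetricD:
  assumes "central_symmetric z"
  shows "z \<odot> a = a \<odot> z" "bar R z = z" "bar R (z \<odot> a) = z \<odot> bar R a"
  using assms by (auto simp: central_symmetric_def bar_mul)

lemma central_symmetric_apow:
  assumes z: "central_symmetric z"
  shows "central_symmetric (apow R z k)"
proof (induction k)
  case 0
  show ?case by (simp add: central_symmetric_def one_mul mul_one)
next
  case (Suc k)
  have "z \<odot> apow R z k \<odot> a = a \<odot> (z \<odot> apow R z k)" for a
    by (metis mul_assoc central_symmetricD(1)[OF z] central_symmetricD(1)[OF Suc])
  then show ?case
    by (simp add: central_symmetric_def apow_Suc central_symmetricD(3)[OF z] central_symmetricD(2)[OF Suc])
qed

end

locale matrix_lie_algebra = involutive_algebra R
  for R :: "('k::field_char_0, 'r::ab_group_add, 'm) inv_alg_scheme" +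
  fixes n :: nat and \<rho> :: 'k
  assumes n: "n \<ge> 3" and \<rho>: "\<rho> \<in> {1, -1}"
begin

abbreviation f where "f \<equiv> fmat R n"
abbreviation g where "g \<equiv> gmat R n \<rho>"
abbreviation h where "h \<equiv> hmat R n \<rho>"
abbreviation L where "L \<equiv> g_lie R n \<rho>"
abbreviation bracket where "bracket X Y \<equiv> mat_mul R (2 * n) X Y - mat_mul R (2 * n) Y X"

lemma L_simps [simp]:
  "lzero L = 0" "ladd L = (+)" "lscal L = mat_scal R" "brk L = bracket"
  by (auto simp: g_lie_def gl_def)

section \<open>Bracket relations between root elements\<close>

lemma bracket_f_f:
  assumes "i \<in> {1..n}" "j \<in> {1..n}" "k \<in> {1..n}" "i \<noteq> j" "j \<noteq> k" "i \<noteq> k"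
  shows "bracket (f i j a) (f j k b) = f i k (a \<odot> b)"
  using assms
  by (simp add: fmat_def mat_mul_diff_left mat_mul_diff_right mat_mul_emat bar_mul)

lemma bracket_f_f_opposite:
  assumes "i \<in> {1..n}" "j \<in> {1..n}" "i \<noteq> j"
  shows "bracket (f i j a) (f j i b) = f i i (a \<odot> b) - f j j (b \<odot> a)"
  using assms
  by (simp add: fmat_def mat_mul_diff_left mat_mul_diff_right mat_mul_emat bar_mul)

lemma bracket_f_g:
  assumes "i \<in> {1..n}" "j \<in> {1..n}" "k \<in> {1..n}" "i \<noteq> k" "j \<noteq> k"
  shows "bracket (f i k a) (g k j b) = g i j (a \<odot> b)"
  using assms
  by (simp add: fmat_def gmat_def mat_mul_diff_left mat_mul_diff_right mat_scal_emat mat_mul_emat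
      bar_mul scal_mul mul_scal)

lemma bracket_h_f:
  assumes "i \<in> {1..n}" "j \<in> {1..n}" "k \<in> {1..n}" "i \<noteq> k" "j \<noteq> k"
  shows "bracket (h i k a) (f k j b) = h i j (a \<odot> b)"
  using assms
  by (simp add: fmat_def hmat_def mat_mul_diff_left mat_mul_diff_right mat_scal_emat mat_mul_emat
      bar_mul scal_mul mul_scal)

lemma bracket_g_h_one:
  assumes "i \<in> {1..n}" "j \<in> {1..n}" "i \<noteq> j"
  shows "bracket (g i j a) (h j i (aone R)) = f i i a + f j j (bar R a)"
  using assms \<rho>
  by (auto simp: fmat_def gmat_def hmat_def mat_mul_diff_left mat_mul_diff_right mat_scal_emat
      mat_mul_emat scal_mul mul_scal mul_one one_mul bar_bar)

lemma f_add: "f i j (a + b) = f i j a + f i j b"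
  and f_diff: "f i j (a - b) = f i j a - f i j b"
  and f_scal: "f i j (scal R c a) = mat_scal R c (f i j a)"
  and g_add: "g i j (a + b) = g i j a + g i j b"
  and h_add: "h i j (a + b) = h i j a + h i j b"
  by (simp_all add: fmat_def gmat_def hmat_def bar_add bar_diff bar_scal emat_add emat_diff
      mat_scal_emat[symmetric] V.scale_right_distrib M.scale_right_diff_distrib M.scale_right_distrib)

lemma f_zero: "f i j 0 = 0"
  using f_add[of i j 0 0] by simp

lemma f_sum: "f i j (\<Sum>k\<in>A. u k) = (\<Sum>k\<in>A. f i j (u k))"
  by (induction A rule: infinite_finite_induct) (simp_all add: f_add f_zero)

text \<open>The generators are listed only for \<open>i \<le> j\<close>; this recovers the remaining
  index pairs up to a sign.\<close>

lemma g_swap: "g i j a = mat_scal R (- \<rho>) (g j i (bar R a))"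
  and h_swap: "h i j a = mat_scal R (- \<rho>) (h j i (bar R a))"
  using \<rho> by (auto simp: gmat_def hmat_def mat_scal_emat M.scale_right_diff_distrib bar_bar emat_uminus)

lemma mat_lmul_root:
  assumes "central_symmetric z"
  shows "mat_lmul z (f i j a) = f i j (z \<odot> a)"
    and "mat_lmul z (g i j a) = g i j (z \<odot> a)"
    and "mat_lmul z (h i j a) = h i j (z \<odot> a)"
  by (simp_all add: fmat_def gmat_def hmat_def mat_lmul_diff mat_lmul_scal mat_lmul_emat
      central_symmetricD(3)[OF assms])

lemma bracket_lmul:
  assumes "central_symmetric z"
  shows "bracket (mat_lmul z X) Y = mat_lmul z (bracket X Y)"
    and "bracket X (mat_lmul z Y) = mat_lmul z (bracket X Y)"
  using central_symmetricD(1)[OF assms]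
  by (simp_all add: mat_mul_lmul_left mat_mul_lmul_right mat_lmul_diff)

section \<open>The generated Lie algebra and some of its elements\<close>

lemma lin_subspace_iff:
  "lin_subspace L U \<longleftrightarrow> U \<subseteq> carr L \<and> M.subspace U"
  by (auto simp: lin_subspace_def M.subspace_def)

lemma gl_subspace_iff:
  "lin_subspace (gl R (2 * n)) U \<longleftrightarrow> U \<subseteq> carr (gl R (2 * n)) \<and> M.subspace U"
  by (auto simp: lin_subspace_def M.subspace_def gl_def)

lemma gl_subalgebra_iff:
  "lie_subalgebra (gl R (2 * n)) U \<longleftrightarrow>
     U \<subseteq> carr (gl R (2 * n)) \<and> M.subspace U \<and> (\<forall>x\<in>U. \<forall>y\<in>U. bracket x y \<in> U)"
  by (simp add: lie_subalgebra_def gl_subspace_iff) (simp add: gl_def)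

lemma root_elems_gl: "root_elems R n \<rho> UNIV \<subseteq> carr (gl R (2 * n))"
  by (auto simp: root_elems_def gl_def fmat_def gmat_def hmat_def emat_def mat_scal_def)

lemma gl_subalgebra: "lie_subalgebra (gl R (2 * n)) (carr (gl R (2 * n)))"
  by (auto simp: gl_subalgebra_iff M.subspace_def mat_mul_def)
     (auto simp: gl_def mat_scal_def)

lemma carr_L: "carr L = lie_generated (gl R (2 * n)) (root_elems R n \<rho> UNIV)"
  by (simp add: g_lie_def)

lemma L_gl: "carr L \<subseteq> carr (gl R (2 * n))"
  using gl_subalgebra root_elems_gl by (auto simp: carr_L lie_generated_def)

lemma L_subspace: "M.subspace (carr L)"
  unfolding carr_L lie_generated_def by (rule M.subspace_Inter) (auto simp: gl_subalgebra_iff)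

lemma L_bracket: "x \<in> carr L \<Longrightarrow> y \<in> carr L \<Longrightarrow> bracket x y \<in> carr L"
  by (auto simp: carr_L lie_generated_def gl_subalgebra_iff)

text \<open>The induction principle for \<open>L\<close>: it is applied to the set of elements of
  \<open>L\<close> that have a property preserved by the Lie operations.\<close>

lemma L_minimal:
  assumes "U \<subseteq> carr L" "M.subspace U" "\<And>x y. x \<in> U \<Longrightarrow> y \<in> U \<Longrightarrow> bracket x y \<in> U"
    "root_elems R n \<rho> UNIV \<subseteq> U"
  shows "U = carr L"
  using assms L_gl by (auto simp: carr_L lie_generated_def gl_subalgebra_iff)

lemma root_elems_L: "root_elems R n \<rho> UNIV \<subseteq> carr L"
  by (auto simp: carr_L lie_generated_def)

lemma f_in_L: "i \<in> {1..n} \<Longrightarrow> j \<in> {1..n} \<Longrightarrow> i \<noteq> j \<Longrightarrow> f i j a \<in> carr L"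
  by (intro subsetD[OF root_elems_L]) (unfold root_elems_def, blast)

lemma g_in_L:
  assumes "i \<in> {1..n}" "j \<in> {1..n}"
  shows "g i j a \<in> carr L"
proof (cases "i \<le> j")
  case True
  then show ?thesis
    using assms by (intro subsetD[OF root_elems_L]) (unfold root_elems_def, blast)
next
  case False
  then have "g j i (bar R a) \<in> carr L"
    using assms by (intro subsetD[OF root_elems_L]) (unfold root_elems_def, use nat_le_linear in blast)
  then show ?thesis using M.subspace_scale[OF L_subspace] by (subst g_swap) blast
qed

lemma h_in_L:
  assumes "i \<in> {1..n}" "j \<in> {1..n}"
  shows "h i j a \<in> carr L"
proof (cases "i \<le> j")
  case True
  then show ?thesis
    using assms by (intro subsetD[OF root_elems_L]) (unfold root_elems_def, blast)
next
  case False
  then have "h j i (bar R a) \<in> carr L"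
    using assms by (intro subsetD[OF root_elems_L]) (unfold root_elems_def, use nat_le_linear in blast)
  then show ?thesis using M.subspace_scale[OF L_subspace] by (subst h_swap) blast
qed

lemma f_diff_in_L:
  assumes "i \<in> {1..n}" "j \<in> {1..n}"
  shows "f i i a - f j j a \<in> carr L"
proof (cases "i = j")
  case True
  then show ?thesis using M.subspace_0[OF L_subspace] by simp
next
  case False
  then show ?thesis
    using bracket_f_f_opposite[OF assms False, of a "aone R"] L_bracket[OF f_in_L f_in_L] assms
    by (metis mul_one one_mul)
qed

text \<open>The bracket of \<open>f 1 2 a\<close> and \<open>f 2 1 b\<close> is
  \<open>f 1 1 (a \<odot> b) - f 2 2 (b \<odot> a)\<close>; a difference
  \<open>f 2 2 - f 1 1\<close> moves the second term to the first diagonal place.\<close>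

lemma f11_commutator_in_L: "f 1 1 (a \<odot> b - b \<odot> a) \<in> carr L"
proof -
  have "bracket (f 1 2 a) (f 2 1 b) + (f 2 2 (b \<odot> a) - f 1 1 (b \<odot> a)) \<in> carr L"
    using n by (intro M.subspace_add[OF L_subspace] L_bracket f_in_L f_diff_in_L) auto
  then show ?thesis using n by (simp add: bracket_f_f_opposite f_diff)
qed

text \<open>The bracket of \<open>g 1 2 a\<close> and \<open>h 2 1 (aone R)\<close> is
  \<open>f 1 1 a + f 2 2 (bar R a)\<close>, and the second term is again moved to the first diagonal
  place.\<close>

lemma f11_symmetrized_in_L: "f 1 1 (a + bar R a) \<in> carr L"
proof -
  have "bracket (g 1 2 a) (h 2 1 (aone R)) - (f 2 2 (bar R a) - f 1 1 (bar R a)) \<in> carr L"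
    using n by (intro M.subspace_diff[OF L_subspace] L_bracket g_in_L h_in_L f_diff_in_L) auto
  then show ?thesis using n by (simp add: bracket_g_h_one f_add)
qed

section \<open>Ideals of \<open>L\<close> and multiplication by central symmetric elements\<close>

lemma lie_ideal_iff:
  "lie_ideal L U \<longleftrightarrow>
     U \<subseteq> carr L \<and> M.subspace U \<and> (\<forall>x\<in>carr L. \<forall>y\<in>U. bracket x y \<in> U)"
  by (auto simp: lie_ideal_def lin_subspace_iff)

lemma lie_ideal_right:
  assumes "lie_ideal L U" "x \<in> U" "y \<in> carr L"
  shows "bracket x y \<in> U"
proof -
  have "M.subspace U" "bracket y x \<in> U" using assms by (auto simp: lie_ideal_iff)
  then have "- bracket y x \<in> U" by (rule M.subspace_neg)
  then show ?thesis by simp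
qed

text \<open>The detour through the index 3, available as \<open>n \<ge> 3\<close>, multiplies the
  entry by \<open>b\<close> and returns to the place \<open>(1, 2)\<close>.\<close>

lemma f12_mul_in_ideal:
  assumes U: "lie_ideal L U" and a: "f 1 2 a \<in> U"
  shows "f 1 2 (a \<odot> b) \<in> U"
proof -
  have "bracket (bracket (f 1 2 a) (f 2 3 b)) (f 3 2 (aone R)) \<in> U"
    using n by (intro lie_ideal_right[OF U] a f_in_L) auto
  then show ?thesis using n by (simp add: bracket_f_f mul_one)
qed

text \<open>Brackets with suitable \<open>f\<close> move the row or the column index and multiply
  the entry. As \<open>n \<ge> 3\<close>, there is always an index different from two given ones to
  pass through.\<close>

lemma ideal_eq_L:
  assumes U: "lie_ideal L U" and f12: "f 1 2 (aone R) \<in> U"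
  shows "U = carr L"
proof (rule L_minimal)
  show "U \<subseteq> carr L" "M.subspace U" using U by (auto simp: lie_ideal_iff)
  show "bracket x y \<in> U" if "x \<in> U" "y \<in> U" for x y using U that by (auto simp: lie_ideal_iff)
  have left: "f k j (b \<odot> a) \<in> U"
    if "f i j a \<in> U" "i \<in> {1..n}" "j \<in> {1..n}" "k \<in> {1..n}" "i \<noteq> j" "k \<noteq> i" "k \<noteq> j" for i j k a b
  proof -
    have "bracket (f k i b) (f i j a) \<in> U"
      using U f_in_L that by (auto simp: lie_ideal_iff)
    then show ?thesis using that by (simp add: bracket_f_f)
  qed
  have right: "f i k (a \<odot> b) \<in> U"
    if "f i j a \<in> U" "i \<in> {1..n}" "j \<in> {1..n}" "k \<in> {1..n}" "i \<noteq> j" "k \<noteq> i" "k \<noteq> j" for i j k a b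
  proof -
    have "bracket (f i j a) (f j k b) \<in> U"
      using that by (intro lie_ideal_right[OF U] f_in_L) auto
    then show ?thesis using that by (simp add: bracket_f_f)
  qed
  have third: "\<exists>k\<in>{1..n}. k \<noteq> i \<and> k \<noteq> j" for i j
  proof -
    have "\<exists>k\<in>{1,2,3}. k \<noteq> i \<and> k \<noteq> j" by (cases "i = 1 \<or> j = 1"; cases "i = 2 \<or> j = 2") auto
    then show ?thesis using n by fastforce
  qed
  have f12a: "f 1 2 a \<in> U" for a
    using f12_mul_in_ideal[OF U f12, of a] by (simp add: one_mul)
  \<comment> \<open>The order matters: first row 1, then every column but the first, and finally the
    first column by way of a third index.\<close>
  have f1: "f 1 k a \<in> U" if "k \<in> {1..n}" "k \<noteq> 1" for k a
    using right[OF f12a[of a], of k "aone R"] f12a that n by (cases "k = 2") (auto simp: mul_one)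
  have f_off: "f i k a \<in> U" if "i \<in> {1..n}" "k \<in> {1..n}" "k \<noteq> 1" "i \<noteq> k" for i k a
    using left[OF f1[of k a], of i "aone R"] f1 that by (cases "i = 1") (auto simp: one_mul)
  have f_U: "f i k a \<in> U" if ik: "i \<in> {1..n}" "k \<in> {1..n}" "i \<noteq> k" for i k a
  proof (cases "k = 1")
    case True
    obtain j where "j \<in> {1..n}" "j \<noteq> i" "j \<noteq> 1" using third by blast
    then show ?thesis using right[OF f_off[of i j a], of k "aone R"] ik True by (auto simp: mul_one)
  qed (use f_off ik in blast)
  have g_U: "g i j a \<in> U" if ij: "i \<in> {1..n}" "j \<in> {1..n}" for i j a
  proof -
    obtain k where k: "k \<in> {1..n}" "k \<noteq> i" "k \<noteq> j" using third by blast
    have "bracket (f i k a) (g k j (aone R)) \<in> U"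
      using ij k by (intro lie_ideal_right[OF U] f_U g_in_L) auto
    then show ?thesis using ij k by (simp add: bracket_f_g mul_one)
  qed
  have h_U: "h i j a \<in> U" if ij: "i \<in> {1..n}" "j \<in> {1..n}" for i j a
  proof -
    obtain k where k: "k \<in> {1..n}" "k \<noteq> i" "k \<noteq> j" using third by blast
    have "bracket (h i k (aone R)) (f k j a) \<in> U"
      using U f_U h_in_L ij k by (auto simp: lie_ideal_iff)
    then show ?thesis using ij k by (simp add: bracket_h_f one_mul)
  qed
  show "root_elems R n \<rho> UNIV \<subseteq> U" using f_U g_U h_U by (auto simp: root_elems_def)
qed

text \<open>The elements of \<open>L\<close> that \<open>mat_lmul z\<close> maps into
  \<open>L\<close> form a subalgebra, because the bracket is linear over \<open>z\<close>, and they
  include the generators.\<close>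

lemma mat_lmul_L:
  assumes z: "central_symmetric z" and X: "X \<in> carr L"
  shows "mat_lmul z X \<in> carr L"
proof -
  have "{X \<in> carr L. mat_lmul z X \<in> carr L} = carr L"
  proof (rule L_minimal)
    show "M.subspace {X \<in> carr L. mat_lmul z X \<in> carr L}"
      using L_subspace by (auto simp: M.subspace_def mat_lmul_add mat_lmul_scal mat_lmul_zero)
    show "root_elems R n \<rho> UNIV \<subseteq> {X \<in> carr L. mat_lmul z X \<in> carr L}"
      using root_elems_L f_in_L g_in_L h_in_L
      by (auto simp: root_elems_def mat_lmul_root[OF z])
  qed (use L_bracket in \<open>auto simp: bracket_lmul(1)[OF z, symmetric]\<close>)
  then show ?thesis using X by blast
qed

text \<open>The elements that \<open>mat_lmul z\<close> maps into \<open>U\<close> form an ideal of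
  \<open>L\<close>. It contains \<open>f 1 2 (aone R)\<close>, whose multiple by \<open>z\<close> is
  \<open>f 1 2 z\<close>, so it is all of \<open>L\<close>.\<close>

lemma lmul_L_subset_ideal:
  assumes U: "lie_ideal L U" and z: "central_symmetric z" and "f 1 2 z \<in> U"
    and X: "X \<in> carr L"
  shows "mat_lmul z X \<in> U"
proof -
  have "lie_ideal L {X \<in> carr L. mat_lmul z X \<in> U}"
    using U L_subspace L_bracket
    by (auto simp: lie_ideal_iff M.subspace_def mat_lmul_add mat_lmul_scal mat_lmul_zero
        bracket_lmul(2)[OF z, symmetric])
  moreover have "f 1 2 (aone R) \<in> {X \<in> carr L. mat_lmul z X \<in> U}"
    using assms f_in_L n by (simp add: mat_lmul_root[OF z] mul_one)
  ultimately show ?thesis using ideal_eq_L X by blast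
qed

end

section \<open>Ideals with semisimple quotient\<close>

locale matrix_lie_ideal = matrix_lie_algebra R n \<rho>
  for R :: "('k::field_char_0, 'r::ab_group_add, 'm) inv_alg_scheme" and n \<rho> +
  fixes \<J> :: "'r matr set"
  assumes ideal: "lie_ideal (g_lie R n \<rho>) \<J>"
begin

abbreviation Q where "Q \<equiv> lie_quotient L \<J>"
abbreviation \<pi> where "\<pi> \<equiv> lie_coset L \<J>"

lemma J_subspace: "M.subspace \<J>"
  and J_L: "\<J> \<subseteq> carr L"
  and J_bracket: "x \<in> carr L \<Longrightarrow> y \<in> \<J> \<Longrightarrow> bracket x y \<in> \<J>"
  using ideal by (auto simp: lie_ideal_iff)

section \<open>Cosets and the operations of the quotient Lie algebra\<close>

lemma mem_coset_iff: "a \<in> \<pi> x \<longleftrightarrow> a - x \<in> \<J>"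
proof
  assume "a - x \<in> \<J>"
  then have "x + (a - x) \<in> \<pi> x" unfolding lie_coset_def L_simps by (rule imageI)
  then show "a \<in> \<pi> x" by simp
qed (auto simp: lie_coset_def)

lemma mem_coset_self: "x \<in> \<pi> x"
  using M.subspace_0[OF J_subspace] by (simp add: mem_coset_iff)

lemma coset_eqI: "x - y \<in> \<J> \<Longrightarrow> \<pi> x = \<pi> y"
proof (rule set_eqI)
  fix a assume xy: "x - y \<in> \<J>"
  have "(a - x) + (x - y) \<in> \<J>" if "a - x \<in> \<J>"
    using M.subspace_add[OF J_subspace that xy] .
  moreover have "(a - y) - (x - y) \<in> \<J>" if "a - y \<in> \<J>"
    using M.subspace_diff[OF J_subspace that xy] .
  ultimately show "a \<in> \<pi> x \<longleftrightarrow> a \<in> \<pi> y" by (auto simp: mem_coset_iff)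
qed

lemma coset_eq_iff: "\<pi> x = \<pi> y \<longleftrightarrow> x - y \<in> \<J>"
  using coset_eqI mem_coset_self[of x] by (auto simp: mem_coset_iff)

lemma coset_zero: "\<pi> 0 = \<J>"
  by (simp add: set_eq_iff mem_coset_iff)

lemma coset_eq_J_iff: "\<pi> x = \<J> \<longleftrightarrow> x \<in> \<J>"
  using coset_eq_iff[of x 0] by (simp add: coset_zero)

lemma Q_carr: "carr Q = \<pi> ` carr L" and Q_zero: "lzero Q = \<J>"
  by (simp_all add: lie_quotient_def)

text \<open>An operation on cosets is a union over all choices of representatives; the union
  collapses because every choice gives the same coset.\<close>

lemma Q_add: "ladd Q (\<pi> x) (\<pi> y) = \<pi> (x + y)"
proof -
  have "\<pi> (a + b) = \<pi> (x + y)" if "a \<in> \<pi> x" "b \<in> \<pi> y" for a b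
  proof (rule coset_eqI)
    have "(a - x) + (b - y) \<in> \<J>"
      using that M.subspace_add[OF J_subspace] by (simp only: mem_coset_iff)
    then show "(a + b) - (x + y) \<in> \<J>" by (simp only: add_diff_add)
  qed
  then have "(\<Union>a\<in>\<pi> x. \<Union>b\<in>\<pi> y. \<pi> (a + b)) = \<pi> (x + y)" using mem_coset_self by blast
  then show ?thesis by (simp add: lie_quotient_def)
qed

lemma Q_scal: "lscal Q c (\<pi> x) = \<pi> (mat_scal R c x)"
proof -
  have "\<pi> (mat_scal R c a) = \<pi> (mat_scal R c x)" if "a \<in> \<pi> x" for a
  proof (rule coset_eqI)
    have "mat_scal R c (a - x) \<in> \<J>"
      using that M.subspace_scale[OF J_subspace] by (simp only: mem_coset_iff)
    then show "mat_scal R c a - mat_scal R c x \<in> \<J>" by (simp only: M.scale_right_diff_distrib)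
  qed
  then have "(\<Union>a\<in>\<pi> x. \<pi> (mat_scal R c a)) = \<pi> (mat_scal R c x)" using mem_coset_self by blast
  then show ?thesis by (simp add: lie_quotient_def)
qed

lemma Q_brk:
  assumes x: "x \<in> carr L" and y: "y \<in> carr L"
  shows "brk Q (\<pi> x) (\<pi> y) = \<pi> (bracket x y)"
proof -
  have "\<pi> (bracket a b) = \<pi> (bracket x y)" if a: "a \<in> \<pi> x" and b: "b \<in> \<pi> y" for a b
  proof (rule coset_eqI)
    \<comment> \<open>The difference of the brackets is
      \<open>bracket (a - x) b + bracket x (b - y)\<close>. For the first summand to lie in the
      ideal, \<open>b\<close> itself has to be in \<open>L\<close>.\<close>
    have "(b - y) + y \<in> carr L"
      using b J_L y M.subspace_add[OF L_subspace] unfolding mem_coset_iff by blast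
    then have "bracket (a - x) b \<in> \<J>"
      using a lie_ideal_right[OF ideal] by (simp add: mem_coset_iff)
    moreover have "bracket x (b - y) \<in> \<J>" using b x J_bracket by (simp add: mem_coset_iff)
    ultimately have "bracket (a - x) b + bracket x (b - y) \<in> \<J>"
      by (rule M.subspace_add[OF J_subspace])
    then show "bracket a b - bracket x y \<in> \<J>"
      by (simp add: mat_mul_diff_left mat_mul_diff_right algebra_simps)
  qed
  then have "(\<Union>a\<in>\<pi> x. \<Union>b\<in>\<pi> y. \<pi> (bracket a b)) = \<pi> (bracket x y)"
    using mem_coset_self by blast
  then show ?thesis by (simp add: lie_quotient_def)
qed

lemma coset_image_subspace:
  assumes "U \<subseteq> carr L" "M.subspace U"
  shows "lin_subspace Q (\<pi> ` U)"
  unfolding lin_subspace_def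
proof (intro conjI ballI allI)
  show "\<pi> ` U \<subseteq> carr Q" using assms by (auto simp: Q_carr)
  show "lzero Q \<in> \<pi> ` U"
    using M.subspace_0[OF assms(2)] coset_zero Q_zero by (metis image_eqI)
  show "ladd Q A B \<in> \<pi> ` U" if "A \<in> \<pi> ` U" "B \<in> \<pi> ` U" for A B
    using that M.subspace_add[OF assms(2)] by (auto simp: Q_add)
  show "lscal Q c A \<in> \<pi> ` U" if "A \<in> \<pi> ` U" for c A
    using that M.subspace_scale[OF assms(2)] by (auto simp: Q_scal)
qed

lemma lin_span_minimal: "lin_subspace Q U \<Longrightarrow> S \<subseteq> U \<Longrightarrow> lin_span Q S \<subseteq> U"
  by (auto simp: lin_span_def)

lemma lmul_image_subspace:
  assumes "central_symmetric z"
  shows "mat_lmul z ` carr L \<subseteq> carr L" "M.subspace (mat_lmul z ` carr L)"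
proof -
  show "mat_lmul z ` carr L \<subseteq> carr L" using mat_lmul_L[OF assms] by blast
  show "M.subspace (mat_lmul z ` carr L)"
    unfolding M.subspace_def
  proof (intro conjI ballI allI)
    show "0 \<in> mat_lmul z ` carr L"
      using M.subspace_0[OF L_subspace] mat_lmul_zero[of z] by (metis image_eqI)
  qed (use M.subspace_add[OF L_subspace] M.subspace_scale[OF L_subspace] in
      \<open>auto simp flip: mat_lmul_add mat_lmul_scal\<close>)
qed

text \<open>Let \<open>K k\<close> be the image of \<open>z^k L\<close> in the quotient. Brackets of
  two elements of \<open>K k\<close> lie in \<open>K (2 * k)\<close>, so the derived series of the
  ideal \<open>K 1\<close> reaches zero and semisimplicity forces \<open>K 1\<close> to
  vanish.\<close>

lemma nilpotent_lmul_in_ideal: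
  assumes ss: "lie_semisimple Q" and z: "central_symmetric z"
    and nil: "\<And>X. X \<in> carr L \<Longrightarrow> mat_lmul (apow R z N) X \<in> \<J>"
    and X: "X \<in> carr L"
  shows "mat_lmul z X \<in> \<J>"
proof -
  let ?z = "apow R z"
  note zk = central_symmetric_apow[OF z]
  define K where "K k = \<pi> ` (mat_lmul (?z k) ` carr L)" for k
  have K_sub: "lin_subspace Q (K k)" for k
    unfolding K_def by (intro coset_image_subspace lmul_image_subspace zk)
  have lmul_add: "mat_lmul (?z (j + k)) Y = mat_lmul (?z j) (mat_lmul (?z k) Y)" for j k Y
    by (simp add: apow_add mat_lmul_mul)
  have "lie_ideal Q (K 1)"
  proof -
    have "brk Q A B \<in> K 1" if AB: "A \<in> carr Q" "B \<in> K 1" for A B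
    proof -
      obtain x y where xy: "A = \<pi> x" "B = \<pi> (mat_lmul (?z 1) y)" "x \<in> carr L" "y \<in> carr L"
        using AB unfolding Q_carr K_def by blast
      have "brk Q A B = \<pi> (mat_lmul (?z 1) (bracket x y))"
        using xy mat_lmul_L[OF zk] by (simp add: Q_brk bracket_lmul(2)[OF zk])
      then show ?thesis using L_bracket xy by (auto simp: K_def)
    qed
    then show ?thesis using K_sub by (auto simp: lie_ideal_def)
  qed
  moreover have "lie_solvable Q (K 1)"
  proof -
    have derived: "lie_derived Q A \<subseteq> K (Suc (Suc k))" if A: "A \<subseteq> K (Suc k)" for A k
      unfolding lie_derived_def
    proof (intro lin_span_minimal[OF K_sub] subsetI)
      fix B assume "B \<in> {brk Q x y |x y. x \<in> A \<and> y \<in> A}"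
      then obtain x' y' where B: "B = brk Q x' y'" "x' \<in> K (Suc k)" "y' \<in> K (Suc k)"
        using A by blast
      then obtain x y where xy: "B = brk Q (\<pi> (mat_lmul (?z (Suc k)) x)) (\<pi> (mat_lmul (?z (Suc k)) y))"
          "x \<in> carr L" "y \<in> carr L"
        unfolding K_def by blast
      have "B = \<pi> (bracket (mat_lmul (?z (Suc k)) x) (mat_lmul (?z (Suc k)) y))"
        using xy mat_lmul_L[OF zk] by (simp add: Q_brk)
      also have "\<dots> = \<pi> (mat_lmul (?z (Suc k + Suc k)) (bracket x y))"
        by (simp only: bracket_lmul[OF zk] lmul_add)
      \<comment> \<open>Gaining one power of \<open>z\<close> per derivation is enough, so the
        surplus factor \<open>z^k\<close> is absorbed into the element of \<open>L\<close>.\<close>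
      also have "\<dots> = \<pi> (mat_lmul (?z (Suc (Suc k))) (mat_lmul (?z k) (bracket x y)))"
        by (simp flip: lmul_add)
      finally show "B \<in> K (Suc (Suc k))"
        using mat_lmul_L[OF zk L_bracket] xy by (auto simp: K_def)
    qed
    have sub: "(lie_derived Q ^^ i) (K 1) \<subseteq> K (Suc i)" for i
      by (induction i) (use derived in auto)
    have "(lie_derived Q ^^ Suc N) (K 1) \<subseteq> {\<J>}"
    proof -
      have "K (N + 2) \<subseteq> {\<J>}"
        unfolding K_def lmul_add using nil mat_lmul_L[OF zk] coset_eq_J_iff by blast
      then show ?thesis using sub[of "Suc N"] by simp
    qed
    \<comment> \<open>Solvability asks for equality with the zero subspace. With
      \<open>Suc N\<close> steps the last set is a span and so contains the zero coset.\<close>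
    moreover have "\<J> \<in> (lie_derived Q ^^ Suc N) (K 1)"
      by (auto simp: lie_derived_def lin_span_def lin_subspace_def Q_zero)
    ultimately have "(lie_derived Q ^^ Suc N) (K 1) = {lzero Q}" by (auto simp: Q_zero)
    then show ?thesis unfolding lie_solvable_def by blast
  qed
  ultimately have "K 1 = {\<J>}" using ss by (auto simp: lie_semisimple_def Q_zero)
  then have "\<pi> (mat_lmul (?z 1) X) = \<J>" using X by (auto simp: K_def)
  then show ?thesis by (simp add: coset_eq_J_iff apow_Suc mul_one)
qed

section \<open>Consequences of finite dimension and semisimplicity\<close>

lemma finite_dim_span:
  assumes "lie_finite_dim Q"
  shows "\<exists>B. finite B \<and> carr L \<subseteq> M.span (B \<union> \<J>)"
proof -
  obtain C where C: "finite C" "C \<subseteq> carr Q" "lin_span Q C = carr Q"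
    using assms by (auto simp: lie_finite_dim_def)
  obtain B where B: "B \<subseteq> carr L" "finite B" "C = \<pi> ` B"
    using C by (metis Q_carr finite_subset_image)
  \<comment> \<open>The span in the quotient is the least subspace containing \<open>C\<close>, so
    this subspace, which contains \<open>C\<close>, is everything.\<close>
  have "lin_subspace Q (\<pi> ` (carr L \<inter> M.span (B \<union> \<J>)))"
    by (intro coset_image_subspace M.subspace_inter L_subspace M.subspace_span) auto
  moreover have "C \<subseteq> \<pi> ` (carr L \<inter> M.span (B \<union> \<J>))"
    using B by (auto intro!: imageI M.span_base)
  ultimately have sub: "carr Q \<subseteq> \<pi> ` (carr L \<inter> M.span (B \<union> \<J>))"
    using lin_span_minimal C(3) by metis
  have "x \<in> M.span (B \<union> \<J>)" if "x \<in> carr L" for x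
  proof -
    obtain y where y: "\<pi> x = \<pi> y" "y \<in> M.span (B \<union> \<J>)" using sub \<open>x \<in> carr L\<close> by (auto simp: Q_carr)
    then have "(x - y) + y \<in> M.span (B \<union> \<J>)"
      by (intro M.span_add) (auto simp: coset_eq_iff intro: M.span_base)
    then show ?thesis by simp
  qed
  then show ?thesis using B(2) by blast
qed

text \<open>The elements \<open>f 1 2 (apow R c k)\<close> of \<open>L\<close> are dependent modulo
  \<open>\<J>\<close>, which has finite codimension; the coefficients of a relation are those of
  \<open>p\<close>.\<close>

lemma finite_dim_annihilating_poly:
  assumes "lie_finite_dim Q"
  shows "\<exists>p. p \<noteq> 0 \<and> f 1 2 (apoly R p c) \<in> \<J>"
proof -
  obtain B where B: "finite B" "carr L \<subseteq> M.span (B \<union> \<J>)" using finite_dim_span[OF assms] by blast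
  have "f 1 2 (apow R c k) \<in> M.span (B \<union> \<J>)" for k
    using B(2) f_in_L[of 1 2] n by auto
  then obtain u N where u: "\<exists>k\<le>N. u k \<noteq> 0" "(\<Sum>k\<le>N. mat_scal R (u k) (f 1 2 (apow R c k))) \<in> \<J>"
    using M.finite_codim_dependent[OF J_subspace B(1), of "\<lambda>k. f 1 2 (apow R c k)"] by blast
  define p where "p = (\<Sum>k\<le>N. monom (u k) k)"
  have coeff: "coeff p k = (if k \<le> N then u k else 0)" for k
    by (simp add: p_def coeff_sum coeff_monom)
  have "p \<noteq> 0" using u(1) coeff by (metis coeff_0)
  moreover have "degree p \<le> N" by (rule degree_le) (simp add: coeff)
  then have "f 1 2 (apoly R p c) = (\<Sum>k\<le>N. mat_scal R (u k) (f 1 2 (apow R c k)))"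
    by (simp add: apoly_eq_sum f_sum f_scal coeff)
  ultimately show ?thesis using u(2) by metis
qed

text \<open>Evaluating the divisibility at \<open>c\<close> makes \<open>c^N z^N\<close> a right
  multiple of \<open>p(c)\<close>, where \<open>z = r(c)\<close>. The inverse \<open>y\<close>
  cancels \<open>c^N\<close>, so \<open>f 1 2 (z^N)\<close> lies in the ideal and \<open>z\<close>
  acts nilpotently on the quotient.\<close>

lemma radical_lmul_in_ideal:
  assumes ss: "lie_semisimple Q" and z: "central_symmetric (apoly R r c)"
    and y: "c \<odot> y = aone R"
    and p: "f 1 2 (apoly R p c) \<in> \<J>" and dvd: "p dvd ([:0, 1:] * r) ^ N"
    and X: "X \<in> carr L"
  shows "mat_lmul (apoly R r c) X \<in> \<J>"
proof -
  let ?z = "apoly R r c"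
  obtain s where s: "([:0, 1:] * r) ^ N = p * s" using dvd by (auto elim: dvdE)
  have "apoly R p c \<odot> apoly R s c = apow R c N \<odot> apow R ?z N"
    using arg_cong[OF s, of "\<lambda>p. apoly R p c"]
    by (simp only: power_mult_distrib apoly_mult apoly_power apoly_X)
  then have "apoly R p c \<odot> (apoly R s c \<odot> apow R y N) = apow R c N \<odot> (apow R ?z N \<odot> apow R y N)"
    by (metis mul_assoc)
  also have "\<dots> = (apow R c N \<odot> apow R y N) \<odot> apow R ?z N"
    by (simp only: mul_assoc central_symmetricD(1)[OF central_symmetric_apow[OF z]])
  also have "\<dots> = apow R ?z N" by (simp add: apow_left_inverse[OF y] one_mul)
  finally have "f 1 2 (apow R ?z N) \<in> \<J>"
    using f12_mul_in_ideal[OF ideal p] by metis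
  then have "mat_lmul (apow R ?z N) Y \<in> \<J>" if "Y \<in> carr L" for Y
    using lmul_L_subset_ideal[OF ideal central_symmetric_apow[OF z]] that by blast
  then show ?thesis using nilpotent_lmul_in_ideal[OF ss z _ X] by blast
qed

text \<open>Each generator with argument \<open>z \<odot> a + w \<odot> b\<close> is the sum of a
  \<open>z\<close>-multiple and a \<open>w\<close>-multiple of elements of \<open>L\<close>. Only
  \<open>f 1 1\<close> needs care, since \<open>f 1 1 a\<close> itself may fail to lie in
  \<open>L\<close>.\<close>

lemma g_under_subset_ideal:
  assumes z: "central_symmetric z" and zL: "\<And>X. X \<in> carr L \<Longrightarrow> mat_lmul z X \<in> \<J>"
    and w: "central_symmetric w" and wL: "\<And>X. X \<in> carr L \<Longrightarrow> mat_lmul w X \<in> \<J>"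
    and J: "J \<subseteq> {z \<odot> a + w \<odot> b | a b. True}"
  shows "g_under R n \<rho> J \<subseteq> \<J>"
proof -
  note add = M.subspace_add[OF J_subspace]
  note lmul = mat_lmul_root[OF z, symmetric] mat_lmul_root[OF w, symmetric]
  have dec: "\<exists>a b. x = z \<odot> a + w \<odot> b" if "x \<in> J" for x using subsetD[OF J that] by simp
  have f11_sub: "V.subspace {a. f 1 1 a \<in> \<J>}"
    using J_subspace by (auto simp: V.subspace_def M.subspace_def f_add f_scal f_zero)
  have comm: "f 1 1 b \<in> \<J>" if "b \<in> comm_span R J UNIV" for b
  proof -
    have "f 1 1 (x \<odot> y - y \<odot> x) \<in> \<J>" if "x \<in> J" for x y
    proof -
      obtain a b where x: "x = z \<odot> a + w \<odot> b" using dec \<open>x \<in> J\<close> by blast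
      have "y \<odot> (z \<odot> a) = z \<odot> (y \<odot> a)" "y \<odot> (w \<odot> b) = w \<odot> (y \<odot> b)"
        by (metis mul_assoc central_symmetricD(1)[OF z], metis mul_assoc central_symmetricD(1)[OF w])
      then have "x \<odot> y - y \<odot> x = z \<odot> (a \<odot> y - y \<odot> a) + w \<odot> (b \<odot> y - y \<odot> b)"
        by (simp add: x add_mul mul_add mul_diff mul_assoc)
      then show ?thesis
        using add[OF zL[OF f11_commutator_in_L] wL[OF f11_commutator_in_L]] by (simp only: f_add lmul)
    qed
    then have "V.span {a \<odot> b - b \<odot> a | a b. a \<in> J \<and> b \<in> UNIV} \<subseteq> {a. f 1 1 a \<in> \<J>}"
      by (intro V.span_minimal f11_sub) auto
    then show ?thesis using \<open>b \<in> comm_span R J UNIV\<close> by (auto simp: comm_span_def)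
  qed
  have sym: "f 1 1 x \<in> \<J>" if "x \<in> J" "x \<in> sym_part R" for x
  proof -
    obtain a b where x: "x = z \<odot> a + w \<odot> b" using dec \<open>x \<in> J\<close> by blast
    \<comment> \<open>The coefficients \<open>a\<close> and \<open>b\<close> of a symmetric
      \<open>x\<close> need not be symmetric. Symmetrizing them represents \<open>x + x\<close>, and
      characteristic 0 allows halving.\<close>
    have "x + bar R x = z \<odot> (a + bar R a) + w \<odot> (b + bar R b)"
      unfolding x bar_add central_symmetricD(3)[OF z] central_symmetricD(3)[OF w] mul_add
      by (simp add: algebra_simps)
    then have "f 1 1 (x + bar R x) \<in> \<J>"
      using add[OF zL[OF f11_symmetrized_in_L] wL[OF f11_symmetrized_in_L]] by (simp only: f_add lmul)
    then have "f 1 1 (scal R (1 / 2) (x + x)) \<in> \<J>"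
      using that M.subspace_scale[OF J_subspace] by (simp add: f_scal sym_part_def)
    moreover have "scal R (1 / 2) (x + x) = scal R (1 / 2 + 1 / 2) x"
      by (simp only: V.scale_right_distrib V.scale_left_distrib)
    ultimately show ?thesis by simp
  qed
  have "f 1 1 ` {a + b | a b. a \<in> J \<inter> sym_part R \<and> b \<in> comm_span R J UNIV} \<subseteq> \<J>"
    using comm sym add by (auto simp: f_add)
  moreover have "f i i a - f 1 1 a \<in> \<J>" if "i \<in> {2..n}" "a \<in> J" for i a
  proof -
    obtain b c where a: "a = z \<odot> b + w \<odot> c" using dec \<open>a \<in> J\<close> by blast
    have "f i i a - f 1 1 a = mat_lmul z (f i i b - f 1 1 b) + mat_lmul w (f i i c - f 1 1 c)"
      by (simp add: a f_add lmul mat_lmul_diff)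
    then show ?thesis using that add zL wL f_diff_in_L n by auto
  qed
  moreover have "root_elems R n \<rho> J \<subseteq> \<J>"
  proof -
    have "f i j a \<in> \<J>" if "i \<in> {1..n}" "j \<in> {1..n}" "i \<noteq> j" "a \<in> J" for i j a
    proof -
      obtain b c where "a = z \<odot> b + w \<odot> c" using dec \<open>a \<in> J\<close> by blast
      then show ?thesis using that add[OF zL wL] f_in_L by (simp add: f_add lmul)
    qed
    moreover have "g i j a \<in> \<J>" if "i \<in> {1..n}" "j \<in> {1..n}" "a \<in> J" for i j a
    proof -
      obtain b c where "a = z \<odot> b + w \<odot> c" using dec \<open>a \<in> J\<close> by blast
      then show ?thesis using that add[OF zL wL] g_in_L by (simp add: g_add lmul)
    qed
    moreover have "h i j a \<in> \<J>" if "i \<in> {1..n}" "j \<in> {1..n}" "a \<in> J" for i j a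
    proof -
      obtain b c where "a = z \<odot> b + w \<odot> c" using dec \<open>a \<in> J\<close> by blast
      then show ?thesis using that add[OF zL wL] h_in_L by (simp add: h_add lmul)
    qed
    ultimately show ?thesis unfolding root_elems_def by blast
  qed
  moreover have "lin_subspace (gl R (2 * n)) \<J>"
    using J_subspace J_L L_gl by (auto simp: gl_subspace_iff)
  ultimately show ?thesis
    unfolding g_under_def g_sum_def lin_span_def by (intro Inter_lower) auto
qed

end

section \<open>Quantum tori\<close>

text \<open>If \<open>v\<close> is inverse to \<open>u\<close> and conjugation by \<open>u\<close>
  has square the identity, this is the projection onto the elements commuting with
  \<open>u\<close>.\<close>

definition (in unital_algebra) conj_average :: "'r \<Rightarrow> 'r \<Rightarrow> 'r \<Rightarrow> 'r" where
  "conj_average u v x = scal R (1 / 2) (x + u \<odot> x \<odot> v)"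

context involutive_algebra
begin

lemma conj_average_add: "conj_average u v (x + y) = conj_average u v x + conj_average u v y"
  unfolding conj_average_def V.scale_right_distrib[symmetric] add_mul mul_add
  by (simp add: algebra_simps)

lemma conj_average_scal: "conj_average u v (scal R c x) = scal R c (conj_average u v x)"
  by (simp add: conj_average_def mul_scal scal_mul V.scale_right_distrib mult.commute)

lemma conj_average_ideal:
  assumes "alg_ideal R J" "x \<in> J"
  shows "conj_average u v x \<in> J"
  using assms V.subspace_add V.subspace_scale by (auto simp: alg_ideal_def conj_average_def)

text \<open>The defect \<open>x - u x v = [x v, u]\<close> is a commutator.\<close>

lemma conj_average_commutator:
  assumes J: "alg_ideal R J" and x: "x \<in> J" and uv: "v \<odot> u = aone R"
  shows "x - conj_average u v x \<in> comm_span R J UNIV"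
proof -
  have "x \<odot> v \<odot> u - u \<odot> (x \<odot> v) \<in> comm_span R J UNIV"
    unfolding comm_span_def using J x by (intro V.span_base) (auto simp: alg_ideal_def)
  then have "scal R (1 / 2) (x - u \<odot> x \<odot> v) \<in> comm_span R J UNIV"
    unfolding comm_span_def by (intro V.span_scale) (simp add: mul_assoc uv mul_one)
  moreover have "x - conj_average u v x = scal R (1 / 2) (x - u \<odot> x \<odot> v)"
  proof -
    have "x = scal R (1 / 2 + 1 / 2) x" by simp
    also have "\<dots> = scal R (1 / 2) x + scal R (1 / 2) x" by (rule V.scale_left_distrib)
    finally have "x = scal R (1 / 2) x + scal R (1 / 2) x" .
    then show ?thesis
      unfolding conj_average_def V.scale_right_distrib V.scale_right_diff_distrib
      by (metis add_diff_cancel_left add_diff_cancel_left')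
  qed
  ultimately show ?thesis by simp
qed

text \<open>Centrality lets left factors move past \<open>z\<close> and \<open>w\<close>, so right
  multiples already give a two-sided ideal. It bounds the ideal generated by \<open>z\<close> and
  \<open>w\<close> from above.\<close>

lemma alg_ideal_two_central:
  assumes z: "\<And>a. z \<odot> a = a \<odot> z" and w: "\<And>a. w \<odot> a = a \<odot> w"
  shows "alg_ideal R {z \<odot> a + w \<odot> b | a b. True}"
  unfolding alg_ideal_def V.subspace_def
proof (intro conjI ballI allI)
  let ?I = "{z \<odot> a + w \<odot> b | a b. True}"
  show "0 \<in> ?I" by (rule CollectI, rule exI[of _ 0], rule exI[of _ 0]) simp
  fix x assume "x \<in> ?I"
  then obtain a b where x: "x = z \<odot> a + w \<odot> b" by blast
  show "x + y \<in> ?I" if y: "y \<in> ?I" for y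
  proof -
    obtain c d where "y = z \<odot> c + w \<odot> d" using y by blast
    then have "x + y = z \<odot> (a + c) + w \<odot> (b + d)" by (simp add: x mul_add algebra_simps)
    then show ?thesis by blast
  qed
  have "scal R c x = z \<odot> scal R c a + w \<odot> scal R c b" for c
    by (simp add: x mul_scal V.scale_right_distrib)
  then show "scal R c x \<in> ?I" for c by blast
  have "x \<odot> r = z \<odot> (a \<odot> r) + w \<odot> (b \<odot> r)" for r
    by (simp add: x add_mul mul_assoc)
  then show "x \<odot> r \<in> ?I" for r by blast
  have "r \<odot> x = z \<odot> (r \<odot> a) + w \<odot> (r \<odot> b)" for r
    by (metis x mul_add mul_assoc z w)
  then show "r \<odot> x \<in> ?I" for r by blast
qed

end

section \<open>The quantum torus and the projection onto its centre\<close>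

locale quantum_torus =
  fixes q \<theta>1 \<theta>2 :: complex
  assumes signs: "q \<in> {1, -1}" "\<theta>1 \<in> {1, -1}" "\<theta>2 \<in> {1, -1}"

sublocale quantum_torus \<subseteq> involutive_algebra "qtorus q \<theta>1 \<theta>2"
  by (rule qtorus_involutive[OF signs])

context quantum_torus
begin

abbreviation C where "C \<equiv> qtorus q \<theta>1 \<theta>2"
abbreviation times_C (infixl \<open>\<odot>\<close> 70) where "a \<odot> b \<equiv> amul C a b"

text \<open>Projection onto the centre: for \<open>q = -1\<close> it kills the monomials with an odd exponent,
  for \<open>q = 1\<close> it is the identity.\<close>

definition central_part :: "laurent2 \<Rightarrow> laurent2" where
  "central_part x = conj_average t2 t2_inv (conj_average t1 t1_inv x)"

lemma central_part_add: "central_part (x + y) = central_part x + central_part y"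
  by (simp add: central_part_def conj_average_add)

lemma central_part_scal: "central_part (scal C c x) = scal C c (central_part x)"
  by (simp add: central_part_def conj_average_scal)

lemma central_part_diff: "central_part (x - y) = central_part x - central_part y"
  using central_part_add[of "x - y" y] by (simp add: algebra_simps)

text \<open>Conjugation by \<open>t1\<close> scales the monomial by \<open>q powi (- b)\<close>,
  conjugation by \<open>t2\<close> by \<open>q powi a\<close>. For \<open>q\<close> a sign, the
  resulting factor is 1 if both scalars are 1, and 0 otherwise.\<close>

lemma central_part_single:
  "central_part (Poly_Mapping.single (a, b) u) =
     Poly_Mapping.single (a, b) (u * (1 + q powi (- b)) * (1 + q powi a) / 4)"
  unfolding central_part_def conj_average_def
  by (simp add: qtorus_def t1_def t1_inv_def t2_def t2_inv_def qmul_single pm_scale_single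
      single_add[symmetric] algebra_simps add_divide_distrib)

lemma central_part_bar: "central_part (bar C x) = bar C (central_part x)"
proof (induction x rule: pm_induct)
  case (single k u)
  show ?case
    by (cases k) (simp add: central_part_single qtorus_def qbar_single mult_ac)
next
  case (add x y)
  then show ?case by (simp add: bar_add central_part_add)
qed

text \<open>Monomials commute up to a power of \<open>q\<close>. If the product of two monomials is
  central, their exponents agree modulo the order of \<open>q\<close> and they commute; otherwise
  the projection kills both products.\<close>

lemma central_part_commutator: "central_part (x \<odot> y - y \<odot> x) = 0"
proof (induction x rule: pm_induct)
  case (single k u)
  show ?case
  proof (induction y rule: pm_induct)
    case (single l v)
    obtain a b c d where kl: "k = (a, b)" "l = (c, d)" by fastforce
    show ?case
      using signs(1) unfolding kl
      by (auto simp: qtorus_def qmul_single central_part_diff central_part_single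
          power_int_minus_left add.commute mult.commute)
  next
    case (add y y')
    then show ?case by (simp add: add_mul mul_add central_part_diff central_part_add)
  qed
next
  case (add x x')
  then show ?case by (simp add: add_mul mul_add central_part_diff central_part_add)
qed

lemma central_part_comm_span:
  assumes "x \<in> comm_span C UNIV UNIV"
  shows "central_part x = 0"
proof -
  have "central_part 0 = 0" using central_part_add[of 0 0] by simp
  then have "V.subspace {x. central_part x = 0}"
    by (auto simp: V.subspace_def central_part_add central_part_scal)
  then have "comm_span C UNIV UNIV \<subseteq> {x. central_part x = 0}"
    unfolding comm_span_def by (intro V.span_minimal) (auto simp: central_part_commutator)
  then show ?thesis using assms by blast
qed

lemma central_part_defect:
  assumes "alg_ideal C J" "x \<in> J"
  shows "central_part x \<in> J" "x - central_part x \<in> comm_span C J UNIV"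
proof -
  let ?y = "conj_average t1 t1_inv x"
  have y: "?y \<in> J" by (rule conj_average_ideal[OF assms])
  then show "central_part x \<in> J"
    unfolding central_part_def by (rule conj_average_ideal[OF assms(1)])
  \<comment> \<open>The defect telescopes over the two averages. The second starts from
    \<open>?y\<close>, which is still in \<open>J\<close>, so both defects are commutators of
    elements of \<open>J\<close>.\<close>
  have "(x - ?y) + (?y - central_part x) \<in> comm_span C J UNIV"
    using conj_average_commutator[OF assms, of t1_inv t1]
      conj_average_commutator[OF assms(1) y, of t2_inv t2]
    unfolding comm_span_def by (intro V.span_add) (simp_all add: qtorus_relations central_part_def)
  then show "x - central_part x \<in> comm_span C J UNIV" by simp
qed

text \<open>The two sums differ only in the set of arguments of \<open>f 1 1\<close>, so it suffices
  to compare these subsets of \<open>J\<close>.\<close>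

lemma g_over_eq_g_under:
  assumes J: "alg_ideal C J"
  shows "g_over C n \<rho> J = g_under C n \<rho> J"
proof -
  have "{a + b | a b. a \<in> sym_part C \<and> b \<in> comm_span C UNIV UNIV} \<inter> J =
      {a + b | a b. a \<in> J \<inter> sym_part C \<and> b \<in> comm_span C J UNIV}" (is "?l = ?r")
  proof
    show "?l \<subseteq> ?r"
    proof
      fix x assume "x \<in> ?l"
      then obtain a b where x: "x = a + b" "bar C a = a" "b \<in> comm_span C UNIV UNIV" "x \<in> J"
        by (auto simp: sym_part_def)
      \<comment> \<open>The projection kills the commutator part \<open>b\<close> and commutes with
        the involution, so it inherits the symmetry of \<open>a\<close>.\<close>
      have "central_part x = central_part a"
        by (simp add: x(1) central_part_add central_part_comm_span[OF x(3)])
      then have "bar C (central_part x) = central_part x"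
        using x(2) by (simp flip: central_part_bar)
      then have "central_part x \<in> J \<inter> sym_part C"
        using central_part_defect[OF J x(4)] by (simp add: sym_part_def)
      moreover have "x = central_part x + (x - central_part x)" by simp
      ultimately show "x \<in> ?r" using central_part_defect[OF J x(4)] by blast
    qed
    have "comm_span C J UNIV \<subseteq> comm_span C UNIV UNIV"
      unfolding comm_span_def by (rule V.span_mono) auto
    moreover have "V.subspace J" using J by (simp add: alg_ideal_def)
    moreover have "comm_span C J UNIV \<subseteq> J"
      unfolding comm_span_def using J
      by (intro V.span_minimal) (auto simp: alg_ideal_def intro!: V.subspace_diff)
    ultimately show "?r \<subseteq> ?l" using V.subspace_add by blast
  qed
  then show ?thesis by (simp add: g_over_def g_under_def)
qed

section \<open>The central units \<open>t1^m\<close> and \<open>t2^m\<close>\<close>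

lemma monomial_central:
  assumes "q powi k = 1" "q powi l = 1"
  shows "Poly_Mapping.single (k, l) 1 \<odot> x = x \<odot> Poly_Mapping.single (k, l) 1"
proof (induction x rule: pm_induct)
  case (single i u)
  obtain a b where i: "i = (a, b)" by (cases i)
  have "q powi (l * a) = 1" using assms(2) by (simp add: power_int_mult)
  moreover have "q powi (b * k) = 1"
    using assms(1) by (simp add: mult.commute[of b] power_int_mult)
  ultimately show ?case by (simp add: i qtorus_def qmul_single add.commute)
next
  case (add x y)
  then show ?case by (simp add: add_mul mul_add)
qed

lemma apow_t1: "apow C t1 m = Poly_Mapping.single (int m, 0) 1"
  by (induction m) (simp_all add: apow_Suc, simp_all add: qtorus_def t1_def qmul_single)

lemma apow_t2: "apow C t2 m = Poly_Mapping.single (0, int m) 1"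
  by (induction m) (simp_all add: apow_Suc, simp_all add: qtorus_def t2_def qmul_single)

text \<open>The argument for a single central unit \<open>c\<close>, to be applied to
  \<open>t1^m\<close> with \<open>\<theta> = \<theta>1 ^ m\<close> and to \<open>t2^m\<close> with
  \<open>\<theta> = \<theta>2 ^ m\<close>.\<close>

lemma exists_poly_in_ideal:
  assumes "n \<ge> 3" "\<rho> \<in> {1, -1}"
    and ideal: "lie_ideal (g_lie C n \<rho>) \<J>"
    and fd: "lie_finite_dim (lie_quotient (g_lie C n \<rho>) \<J>)"
    and ss: "lie_semisimple (lie_quotient (g_lie C n \<rho>) \<J>)"
    and central: "\<And>a. c \<odot> a = a \<odot> c" and inv: "c \<odot> y = aone C"
    and bar: "bar C c = scal C \<theta> c" and \<theta>: "\<theta> \<in> {1, -1}"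
  shows "\<exists>r. poly r 0 \<noteq> 0 \<and> degree r > 0 \<and> gcd r (pderiv r) = 1 \<and> pcompose r [:0, \<theta>:] = r \<and>
    central_symmetric (apoly C r c) \<and>
    (\<forall>X\<in>carr (g_lie C n \<rho>). mat_lmul (apoly C r c) X \<in> \<J>)"
proof -
  interpret matrix_lie_ideal C n \<rho> \<J>
    by unfold_locales (use assms in auto)
  obtain p where p: "p \<noteq> 0" "fmat C n 1 2 (apoly C p c) \<in> \<J>"
    using finite_dim_annihilating_poly[OF fd] by blast
  obtain r N where r: "poly r 0 \<noteq> 0" "degree r > 0" "gcd r (pderiv r) = 1"
      "pcompose r [:0, \<theta>:] = r" "p dvd ([:0, 1:] * r) ^ N"
    using exists_squarefree_symmetric_poly[OF p(1) \<theta>] by metis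
  \<comment> \<open>The involution sends \<open>r(c)\<close> to \<open>r(\<theta> c)\<close>, which
    equals \<open>r(c)\<close> by the invariance of \<open>r\<close>.\<close>
  have "bar C (apoly C r c) = apoly C r c"
    using apoly_pcompose_scale[of r \<theta> c] by (metis bar_apoly bar r(4))
  then have z: "central_symmetric (apoly C r c)"
    using apoly_central[OF central] by (simp add: central_symmetric_def)
  then have "\<forall>X\<in>carr (g_lie C n \<rho>). mat_lmul (apoly C r c) X \<in> \<J>"
    using radical_lmul_in_ideal[OF ss z inv p(2) r(5)] by blast
  then show ?thesis using r z by metis
qed

end

theorem theorem4p6:
  fixes n :: nat and \<rho> q \<theta>1 \<theta>2 :: complex and \<J> :: "laurent2 matr set"
  assumes "n \<ge> 3"
    and "\<rho> \<in> {1, -1}"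
    and "(q, \<theta>1, \<theta>2) \<in> qtriples"
    and "lie_ideal (g_lie (qtorus q \<theta>1 \<theta>2) n \<rho>) \<J>"
    and "lie_finite_dim (lie_quotient (g_lie (qtorus q \<theta>1 \<theta>2) n \<rho>) \<J>)"
    and "lie_semisimple (lie_quotient (g_lie (qtorus q \<theta>1 \<theta>2) n \<rho>) \<J>)"
  shows "\<exists>f g :: complex poly.
           poly f 0 * poly g 0 \<noteq> 0 \<and> degree f * degree g > 0 \<and>
           gcd f (pderiv f) = 1 \<and> gcd g (pderiv g) = 1 \<and>
           pcompose f [:0, \<theta>1 ^ mult_order q:] = f \<and>
           pcompose g [:0, \<theta>2 ^ mult_order q:] = g \<and>
           g_over (qtorus q \<theta>1 \<theta>2) n \<rho> (J_ideal q \<theta>1 \<theta>2 f g) \<subseteq> \<J> \<and>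
           g_over (qtorus q \<theta>1 \<theta>2) n \<rho> (J_ideal q \<theta>1 \<theta>2 f g) =
             g_under (qtorus q \<theta>1 \<theta>2) n \<rho> (J_ideal q \<theta>1 \<theta>2 f g)"
proof -
  let ?C = "qtorus q \<theta>1 \<theta>2"
  interpret quantum_torus q \<theta>1 \<theta>2
    using assms(3) by unfold_locales (auto simp: qtriples_def)
  interpret matrix_lie_ideal ?C n \<rho> \<J>
    by unfold_locales (use assms in auto)
  define m where "m = mult_order q"
  have qm: "q ^ m = 1" "q powi (int m) = 1"
    using signs(1) by (auto simp: m_def mult_order_values)
  define c1 where "c1 = apow ?C t1 m"
  define c2 where "c2 = apow ?C t2 m"
  note c = c1_def c2_def apow_t1 apow_t2
  have central: "amul ?C c1 a = amul ?C a c1" "amul ?C c2 a = amul ?C a c2" for a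
    by (simp_all add: c monomial_central qm)
  have inv: "amul ?C c1 (Poly_Mapping.single (- int m, 0) 1) = aone ?C"
      "amul ?C c2 (Poly_Mapping.single (0, - int m) 1) = aone ?C"
    by (simp_all add: c, simp_all add: qtorus_def qmul_single)
  have bar: "bar ?C c1 = scal ?C (\<theta>1 ^ m) c1" "bar ?C c2 = scal ?C (\<theta>2 ^ m) c2"
    by (simp_all add: c, simp_all add: qtorus_def qbar_single pm_scale_single)
  have \<theta>: "\<theta>1 ^ m \<in> {1, -1}" "\<theta>2 ^ m \<in> {1, -1}"
    using signs by (auto simp: minus_one_power_iff split: if_splits)
  obtain r where r: "poly r 0 \<noteq> 0" "degree r > 0" "gcd r (pderiv r) = 1"
      "pcompose r [:0, \<theta>1 ^ m:] = r" "central_symmetric (apoly ?C r c1)"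
      "\<And>X. X \<in> carr (g_lie ?C n \<rho>) \<Longrightarrow> mat_lmul (apoly ?C r c1) X \<in> \<J>"
    using exists_poly_in_ideal[OF assms(1,2,4-6) central(1) inv(1) bar(1) \<theta>(1)] by metis
  obtain s where s: "poly s 0 \<noteq> 0" "degree s > 0" "gcd s (pderiv s) = 1"
      "pcompose s [:0, \<theta>2 ^ m:] = s" "central_symmetric (apoly ?C s c2)"
      "\<And>X. X \<in> carr (g_lie ?C n \<rho>) \<Longrightarrow> mat_lmul (apoly ?C s c2) X \<in> \<J>"
    using exists_poly_in_ideal[OF assms(1,2,4-6) central(2) inv(2) bar(2) \<theta>(2)] by metis
  let ?J = "J_ideal q \<theta>1 \<theta>2 r s"
  let ?z = "apoly ?C r c1" and ?w = "apoly ?C s c2"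
  have J: "?J = gen_ideal ?C {?z, ?w}" by (simp add: J_ideal_def Let_def c1_def c2_def m_def)
  \<comment> \<open>Sums of multiples of \<open>?z\<close> and \<open>?w\<close> form an ideal
    containing both generators; this gives the decomposition of elements of \<open>?J\<close> needed
    for the inclusion.\<close>
  have "?J \<subseteq> {amul ?C ?z a + amul ?C ?w b | a b. True}"
    unfolding J
  proof (rule gen_ideal_minimal)
    show "alg_ideal ?C {amul ?C ?z a + amul ?C ?w b | a b. True}"
      by (rule alg_ideal_two_central) (use r(5) s(5) in \<open>auto simp: central_symmetric_def\<close>)
    have "?z = amul ?C ?z (aone ?C) + amul ?C ?w 0" "?w = amul ?C ?z 0 + amul ?C ?w (aone ?C)" by (simp_all add: mul_one)
    then show "{?z, ?w} \<subseteq> {amul ?C ?z a + amul ?C ?w b | a b. True}" by blast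
  qed
  \<comment> \<open>The inclusion is shown for the lower algebra, whose \<open>f 1 1\<close> part is
    built from symmetric elements of \<open>?J\<close> and from commutators with \<open>?J\<close>;
    equality carries it to the upper one.\<close>
  then have "g_under ?C n \<rho> ?J \<subseteq> \<J>"
    using r(6) s(6) by (intro g_under_subset_ideal[OF r(5) _ s(5)])
  moreover have "g_over ?C n \<rho> ?J = g_under ?C n \<rho> ?J"
    unfolding J by (rule g_over_eq_g_under[OF alg_ideal_gen_ideal])
  ultimately show ?thesis
    using r(1-4) s(1-4) by (intro exI[of _ r] exI[of _ s]) (simp add: m_def)
qed

end
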